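(* Let $f_1,f_2:[0,+\infty)\times[0,+\infty)\to[0,+\infty)$ be continuous and let $k_i,a_i,b_i,c_i,c,m_i,M_i,K$ be as in the context. For $\rho>0$ consider the conditions $(\mathrm I^1_\rho)$: for every $i=1,2$, $\ \sup\bigl\{\frac{f_i(u,v)}{\rho}:(u,v)\in[0,\rho]\times[0,\rho]\bigr\}<m_i$; $(\mathrm I^0_\rho)$: $\ \inf\bigl\{\frac{f_1(u,v)}{\rho}:(u,v)\in[\rho,\rho/c]\times[0,\rho/c]\bigr\}>M_1$ and $\inf\bigl\{\frac{f_2(u,v)}{\rho}:(u,v)\in[0,\rho/c]\times[\rho,\rho/c]\bigr\}>M_2$; $(\mathrm I^0_\rho)^\star$: for some $i\in\{1,2\}$, $\ \inf\bigl\{\frac{f_i(u,v)}{\rho}:(u,v)\in[0,\rho/c]\times[0,\rho/c]\bigr\}>M_i$. Consider the system $$u(t)=\int_0^1k_1(t,s)f_1(u(s),v(s))\,ds,\qquad v(t)=\int_0^1k_2(t,s)f_2(u(s),v(s))\,ds,\qquad t\in[0,1].\tag{E}$$ System (E) has at least one positive solution in $K$ if either of the following holds: $(S_1)$ there exist $\rho_1,\rho_2\in(0,+\infty)$ with $\rho_1/c<\rho_2$ such that $(\mathrm I^0_{\rho_1})$ [or $(\mathrm I^0_{\rho_1})^\star$] and $(\mathrm I^1_{\rho_2})$ hold; $(S_2)$ there exist $\rho_1,\rho_2\in(0,+\infty)$ with $\rho_1<\rho_2$ such that $(\mathrm I^1_{\rho_1})$ and $(\mathrm I^0_{\rho_2})$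 hold. System (E) has at least two positive solutions in $K$ if one of the following holds: $(S_3)$ there exist $\rho_1,\rho_2,\rho_3\in(0,+\infty)$ with $\rho_1/c<\rho_2<\rho_3$ such that $(\mathrm I^0_{\rho_1})$ [or $(\mathrm I^0_{\rho_1})^\star$], $(\mathrm I^1_{\rho_2})$ and $(\mathrm I^0_{\rho_3})$ hold; $(S_4)$ there exist $\rho_1,\rho_2,\rho_3\in(0,+\infty)$ with $\rho_1<\rho_2$ and $\rho_2/c<\rho_3$ such that $(\mathrm I^1_{\rho_1})$, $(\mathrm I^0_{\rho_2})$ and $(\mathrm I^1_{\rho_3})$ hold. System (E) has at least three positive solutions in $K$ if one of the following holds: $(S_5)$ there exist $\rho_1,\rho_2,\rho_3,\rho_4\in(0,+\infty)$ with $\rho_1/c<\rho_2<\rho_3$ and $\rho_3/c<\rho_4$ such that $(\mathrm I^0_{\rho_1})$ [or $(\mathrm I^0_{\rho_1})^\star$], $(\mathrm I^1_{\rho_2})$, $(\mathrm I^0_{\rho_3})$ and $(\mathrm I^1_{\rho_4})$ hold; $(S_6)$ there exist $\rho_1,\rho_2,\rho_3,\rho_4\in(0,+\infty)$ with $\rho_1<\rho_2$ and $\rho_2/c<\rho_3<\rho_4$ such that $(\mathrm I^1_{\rho_1})$, $(\mathrm I^0_{\rho_2})$, $(\mathrm I^1_{\rho_3})$ and $(\mathrm I^0_{\rho_4})$ hold.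
   Context: The kernels on $[0,1]\times[0,1]$ are: $k_1(t,s)=s(1-t)$ if $s\le t$, $k_1(t,s)=t(1-s)$ if $s>t$; and $k_2(t,s)=s$ if $s\le t$, $k_2(t,s)=t$ if $s>t$. Put $[a_1,b_1]=[1/4,3/4]$, $[a_2,b_2]=[1/2,1]$, $c_1=1/4$, $c_2=1/2$, $c=\min\{c_1,c_2\}=1/4$. For $i=1,2$, $$\frac1{m_i}=\sup_{t\in[0,1]}\int_0^1k_i(t,s)\,ds,\qquad\frac1{M_i}=\inf_{t\in[a_i,b_i]}\int_{a_i}^{b_i}k_i(t,s)\,ds.$$ $C[0,1]$ carries the norm $\|w\|=\max_{t\in[0,1]}|w(t)|$ and $C[0,1]\times C[0,1]$ the norm $\|(u,v)\|=\max\{\|u\|,\|v\|\}$. The cone is $K=\tilde K_1\times\tilde K_2$ with $$\tilde K_i=\{w\in C[0,1]: w(t)\ge0\text{ on }[0,1]\text{ and }\min_{t\in[a_i,b_i]}w(t)\ge c_i\|w\|\}.$$ A positive solution in $K$ is a solution $(u,v)\in K$ with $\|(u,v)\|>0$. *)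

theory Defs
  imports "HOL-Analysis.Analysis"
begin

definition kern1 :: "real \<Rightarrow> real \<Rightarrow> real" where
  "kern1 t s = (if s \<le> t then s * (1 - t) else t * (1 - s))"

definition kern2 :: "real \<Rightarrow> real \<Rightarrow> real" where
  "kern2 t s = (if s \<le> t then s else t)"

definition a1 :: real where "a1 = 1/4"
definition b1 :: real where "b1 = 3/4"
definition a2 :: real where "a2 = 1/2"
definition b2 :: real where "b2 = 1"
definition c1 :: real where "c1 = 1/4"
definition c2 :: real where "c2 = 1/2"
definition cmin :: real where "cmin = min c1 c2"

definition m_of :: "(real \<Rightarrow> real \<Rightarrow> real) \<Rightarrow> real" where
  "m_of k = 1 / (SUP t\<in>{0..1}. integral {0..1} (\<lambda>s. k t s))"

definition M_of :: "(real \<Rightarrow> real \<Rightarrow> real) \<Rightarrow> real \<Rightarrow> real \<Rightarrow> real" where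
  "M_of k a b = 1 / (INF t\<in>{a..b}. integral {a..b} (\<lambda>s. k t s))"

definition m1 :: real where "m1 = m_of kern1"
definition m2 :: real where "m2 = m_of kern2"
definition M1 :: real where "M1 = M_of kern1 a1 b1"
definition M2 :: real where "M2 = M_of kern2 a2 b2"

text \<open>Elements of \<open>C[0,1]\<close> are total functions with the fixed value \<open>undefined\<close> off \<open>[0,1]\<close>, so
  that equality of functions is equality on \<open>[0,1]\<close>; counting solutions relies on this.\<close>

definition C01 :: "(real \<Rightarrow> real) set" where
  "C01 = {w. w \<in> extensional {0..1} \<and> continuous_on {0..1} w}"

text \<open>For continuous functions on compact intervals the supremum and infimum below are the maximum
  and minimum.\<close>

definition sup_norm :: "(real \<Rightarrow> real) \<Rightarrow> real" where
  "sup_norm w = (SUP t\<in>{0..1}. \<bar>w t\<bar>)"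

definition pair_norm :: "(real \<Rightarrow> real) \<times> (real \<Rightarrow> real) \<Rightarrow> real" where
  "pair_norm p = max (sup_norm (fst p)) (sup_norm (snd p))"

definition cone_of :: "real \<Rightarrow> real \<Rightarrow> real \<Rightarrow> (real \<Rightarrow> real) set" where
  "cone_of a b c =
     {w \<in> C01. (\<forall>t\<in>{0..1}. w t \<ge> 0) \<and> (INF t\<in>{a..b}. w t) \<ge> c * sup_norm w}"

definition cone_K :: "((real \<Rightarrow> real) \<times> (real \<Rightarrow> real)) set" where
  "cone_K = cone_of a1 b1 c1 \<times> cone_of a2 b2 c2"

definition solves_system ::
  "(real \<times> real \<Rightarrow> real) \<Rightarrow> (real \<times> real \<Rightarrow> real) \<Rightarrow> (real \<Rightarrow> real) \<Rightarrow> (real \<Rightarrow> real) \<Rightarrow> bool" where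
  "solves_system f1 f2 u v \<longleftrightarrow>
     (\<forall>t\<in>{0..1}. u t = integral {0..1} (\<lambda>s. kern1 t s * f1 (u s, v s)) \<and>
                 v t = integral {0..1} (\<lambda>s. kern2 t s * f2 (u s, v s)))"

definition positive_solutions ::
  "(real \<times> real \<Rightarrow> real) \<Rightarrow> (real \<times> real \<Rightarrow> real) \<Rightarrow> ((real \<Rightarrow> real) \<times> (real \<Rightarrow> real)) set" where
  "positive_solutions f1 f2 =
     {(u, v). (u, v) \<in> cone_K \<and> solves_system f1 f2 u v \<and> pair_norm (u, v) > 0}"

definition at_least_positive_solutions ::
  "nat \<Rightarrow> (real \<times> real \<Rightarrow> real) \<Rightarrow> (real \<times> real \<Rightarrow> real) \<Rightarrow> bool" where
  "at_least_positive_solutions n f1 f2 \<longleftrightarrow>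
     (\<exists>S \<subseteq> positive_solutions f1 f2. finite S \<and> card S = n)"

definition cond_I1 ::
  "(real \<times> real \<Rightarrow> real) \<Rightarrow> (real \<times> real \<Rightarrow> real) \<Rightarrow> real \<Rightarrow> bool" where
  "cond_I1 f1 f2 \<rho> \<longleftrightarrow>
     (SUP p\<in>{0..\<rho>} \<times> {0..\<rho>}. f1 p / \<rho>) < m1 \<and>
     (SUP p\<in>{0..\<rho>} \<times> {0..\<rho>}. f2 p / \<rho>) < m2"

definition cond_I0 ::
  "(real \<times> real \<Rightarrow> real) \<Rightarrow> (real \<times> real \<Rightarrow> real) \<Rightarrow> real \<Rightarrow> bool" where
  "cond_I0 f1 f2 \<rho> \<longleftrightarrow>
     (INF p\<in>{\<rho>..\<rho>/cmin} \<times> {0..\<rho>/cmin}. f1 p / \<rho>) > M1 \<and>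
     (INF p\<in>{0..\<rho>/cmin} \<times> {\<rho>..\<rho>/cmin}. f2 p / \<rho>) > M2"

definition cond_I0_star ::
  "(real \<times> real \<Rightarrow> real) \<Rightarrow> (real \<times> real \<Rightarrow> real) \<Rightarrow> real \<Rightarrow> bool" where
  "cond_I0_star f1 f2 \<rho> \<longleftrightarrow>
     (INF p\<in>{0..\<rho>/cmin} \<times> {0..\<rho>/cmin}. f1 p / \<rho>) > M1 \<or>
     (INF p\<in>{0..\<rho>/cmin} \<times> {0..\<rho>/cmin}. f2 p / \<rho>) > M2"

end

theory Submission
  imports Defs "HOL-Complex_Analysis.Great_Picard"
begin

text \<open>
  Solutions are fixed points of an integral operator T on the cone K. Every nonzero element of K
  is uniquely a multiple s b with b in the convex base B = {b. l b = 1} of K, l a positive linear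
  functional. On an annulus {q \<le> 1 \<le> p} cut out by homogeneous functionals, T is thus split
  into a direction in B and a radius in an interval. Replacing the radial part by
  s + \<sigma> (l (T (s b)) - s) keeps the fixed points; the choice \<sigma> = 1 handles compression, and
  \<sigma> = -1 reverses the radial motion and so handles expansion as well. In both cases Schauder's
  theorem on [0,1] \<times> B gives a fixed point, which the boundary inequalities push into the open
  annulus. Condition I1 makes T decrease the norm, and I0 or its starred form makes T increase the
  functional max (min u) (min v) where it equals \<rho>; solutions in different annuli are
  told apart by the values of these two functionals.
\<close>

section \<open>The fixed point theorems of Brouwer and Schauder\<close>

text \<open>The annuli are bounded by level sets of a norm and of a maximum of two minima. The
  latter functional is neither convex nor concave and the annuli are not convex, so Schauder's
  theorem cannot be applied to them directly. The base of the cone is convex because the functional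
  that cuts it out is linear. Here that functional is the sum of the two components at 1/2: this
  point lies in [1/4,3/4] and in [1/2,1], so on the cone the value controls the norm.

  The required gaps between the radii come from two comparisons on K,
  \<open>pmin w \<le> pnorm w\<close> and \<open>pnorm w \<le> 4 * pmin w\<close>, where 4 = 1/c. An
  annulus that starts at \<open>pmin w = \<rho>\<close> and ends at \<open>pnorm w = \<rho>'\<close>
  is nondegenerate in every direction once \<rho>/c < \<rho>', whereas one that starts at
  \<open>pnorm w = \<rho>\<close> and ends at \<open>pmin w = \<rho>'\<close> asks only for \<rho> <
  \<rho>'. Hence the alternating gaps in the six hypotheses.\<close>

lemma tendsto_fun_iff:
  fixes X :: "nat \<Rightarrow> 'a \<Rightarrow> 'b::topological_space"
  shows "X \<longlonglongrightarrow> l \<longleftrightarrow> (\<forall>i. (\<lambda>k. X k i) \<longlonglongrightarrow> l i)"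
  using limitin_componentwise[of "\<lambda>_. euclidean" UNIV X l sequentially]
  by (simp add: euclidean_product_topology)

text \<open>Kuhn's combinatorial lemma on finer and finer grids gives cells in which every
  coordinate has one vertex that \<open>F\<close> does not push down and one that it does not push
  up; an accumulation point of such cells is fixed. The cube sits in the sequence space, with all
  coordinates from \<open>n\<close> on equal to 0, because its dimension is the size of a net found
  inside a later proof and so cannot be a type.\<close>

lemma brouwer_unit_cube:
  fixes n :: nat and F :: "(nat \<Rightarrow> real) \<Rightarrow> nat \<Rightarrow> real"
  defines "Q \<equiv> Pi UNIV (\<lambda>i. if i < n then {0..1} else {0})"
  assumes cont: "\<And>i. i < n \<Longrightarrow> continuous_on Q (\<lambda>t. F t i)"
    and range: "\<And>t i. t \<in> Q \<Longrightarrow> i < n \<Longrightarrow> F t i \<in> {0..1}"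
  obtains t where "t \<in> Q" "\<And>i. i < n \<Longrightarrow> F t i = t i"
proof -
  have cell: "\<exists>t\<in>Q. \<forall>i<n. \<exists>r\<in>Q. \<exists>s\<in>Q.
      (\<forall>j. \<bar>r j - t j\<bar> \<le> 1 / Suc k \<and> \<bar>s j - t j\<bar> \<le> 1 / Suc k) \<and> r i \<le> F r i \<and> F s i \<le> s i"
    for k
  proof -
    define p where "p = Suc k"
    have p: "0 < p" by (simp add: p_def)
    define g where "g x = (\<lambda>i. if i < n then real (x i) / real p else 0)" for x :: "nat \<Rightarrow> nat"
    \<comment> \<open>Kuhn's lemma prescribes label 0 on the lower faces and 1 on the upper ones. As
      \<open>F\<close> stays in [0,1], the prescribed labels still report the direction of
      \<open>F\<close> correctly, which \<open>lab0\<close> and \<open>lab1\<close> record.\<close>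
    define label :: "(nat \<Rightarrow> nat) \<Rightarrow> nat \<Rightarrow> nat" where
      "label x i = (if x i = 0 then 0 else if x i = p then 1 else if g x i \<le> F (g x) i then 0 else 1)"
      for x i
    have gQ: "g x \<in> Q" if "\<forall>i<n. x i \<le> p" for x
      using that p by (auto simp: Q_def g_def)
    have lab0: "g x i \<le> F (g x) i" if "\<forall>i<n. x i \<le> p" "i < n" "label x i = 0" for x i
      using that range[OF gQ, of x i] p
      by (auto simp: label_def g_def split: if_splits)
    have lab1: "F (g x) i \<le> g x i" if "\<forall>i<n. x i \<le> p" "i < n" "label x i \<noteq> 0" for x i
      using that range[OF gQ, of x i] p
      by (auto simp: label_def g_def split: if_splits)
    obtain q where q: "\<forall>i<n. q i < p" and qc: "\<forall>i<n. \<exists>r s. (\<forall>j<n. q j \<le> r j \<and> r j \<le> q j + 1)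
        \<and> (\<forall>j<n. q j \<le> s j \<and> s j \<le> q j + 1) \<and> label r i \<noteq> label s i"
      by (rule kuhn_lemma[OF p, of n label]) (use p in \<open>auto simp: label_def\<close>)
    show ?thesis
    proof (rule bexI[of _ "g q"], intro allI impI)
      show "g q \<in> Q" using q gQ by (meson less_imp_le)
      fix i assume i: "i < n"
      obtain r s where r: "\<forall>j<n. q j \<le> r j \<and> r j \<le> q j + 1"
        and s: "\<forall>j<n. q j \<le> s j \<and> s j \<le> q j + 1" and ne: "label r i \<noteq> label s i"
        using qc i by blast
      have le: "\<forall>j<n. r j \<le> p" "\<forall>j<n. s j \<le> p" using q r s by (fastforce)+
      have near: "\<bar>g x j - g q j\<bar> \<le> 1 / Suc k" if "\<forall>j<n. q j \<le> x j \<and> x j \<le> q j + 1" for x j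
      proof (cases "j < n")
        case True
        then have "real (q j) \<le> real (x j)" "real (x j) \<le> real (q j) + 1"
          using that by (force simp flip: of_nat_Suc)+
        then show ?thesis
          using True p by (simp add: g_def p_def flip: diff_divide_distrib add: divide_right_mono)
      qed (simp add: g_def)
      consider "label r i = 0" "label s i \<noteq> 0" | "label s i = 0" "label r i \<noteq> 0"
        using ne by (auto simp: label_def split: if_splits)
      then show "\<exists>r\<in>Q. \<exists>s\<in>Q. (\<forall>j. \<bar>r j - g q j\<bar> \<le> 1 / Suc k \<and> \<bar>s j - g q j\<bar> \<le> 1 / Suc k)
          \<and> r i \<le> F r i \<and> F s i \<le> s i"
      proof cases
        case 1
        show ?thesis
          by (intro bexI[OF _ gQ[OF le(1)]] bexI[OF _ gQ[OF le(2)]] conjI allI near r s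
              lab0[OF le(1) i 1(1)] lab1[OF le(2) i 1(2)])
      next
        case 2
        show ?thesis
          by (intro bexI[OF _ gQ[OF le(2)]] bexI[OF _ gQ[OF le(1)]] conjI allI near r s
              lab0[OF le(2) i 2(1)] lab1[OF le(1) i 2(2)])
      qed
    qed
  qed
  then obtain t where t: "\<And>k. t k \<in> Q" and "\<forall>k. \<forall>i<n. \<exists>r\<in>Q. \<exists>s\<in>Q.
      (\<forall>j. \<bar>r j - t k j\<bar> \<le> 1 / Suc k \<and> \<bar>s j - t k j\<bar> \<le> 1 / Suc k) \<and> r i \<le> F r i \<and> F s i \<le> s i"
    by metis
  then obtain r s where rs: "\<And>k i. i < n \<Longrightarrow> r k i \<in> Q \<and> s k i \<in> Q \<and>
      (\<forall>j. \<bar>r k i j - t k j\<bar> \<le> 1 / Suc k \<and> \<bar>s k i j - t k j\<bar> \<le> 1 / Suc k)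
      \<and> r k i i \<le> F (r k i) i \<and> F (s k i) i \<le> s k i i"
    by metis
  have "compact Q"
    using compactin_PiE[of "\<lambda>_. euclidean" UNIV "\<lambda>i::nat. if i < n then {0..1::real} else {0}"]
    by (simp add: Q_def euclidean_product_topology PiE_UNIV_domain)
  then obtain l \<phi> where l: "l \<in> Q" and \<phi>: "strict_mono \<phi>" and lim: "(t \<circ> \<phi>) \<longlonglongrightarrow> l"
    using t compact_imp_seq_compact unfolding seq_compact_def by metis
  have Suc0: "(\<lambda>k. 1 / real (Suc (\<phi> k))) \<longlonglongrightarrow> 0"
    using LIMSEQ_subseq_LIMSEQ[OF LIMSEQ_inverse_real_of_nat \<phi>] by (simp add: o_def inverse_eq_divide)
  have near: "(\<lambda>k. x (\<phi> k)) \<longlonglongrightarrow> l" if "\<And>k j. \<bar>x k j - t k j\<bar> \<le> 1 / Suc k"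
    for x :: "nat \<Rightarrow> nat \<Rightarrow> real"
    unfolding tendsto_fun_iff
  proof
    fix j
    have "(\<lambda>k. x (\<phi> k) j - t (\<phi> k) j) \<longlonglongrightarrow> 0"
      by (rule Lim_null_comparison[OF _ Suc0]) (use that in auto)
    moreover have "(\<lambda>k. t (\<phi> k) j) \<longlonglongrightarrow> l j"
      using lim unfolding tendsto_fun_iff by simp
    ultimately show "(\<lambda>k. x (\<phi> k) j) \<longlonglongrightarrow> l j"
      by (drule_tac tendsto_add) auto
  qed
  have "F l i = l i" if i: "i < n" for i
  proof (rule antisym)
    have conv: "(\<lambda>k. F (x (\<phi> k)) i) \<longlonglongrightarrow> F l i" "(\<lambda>k. x (\<phi> k) i) \<longlonglongrightarrow> l i"
      if "\<And>k j. \<bar>x k j - t k j\<bar> \<le> 1 / Suc k" "\<And>k. x k \<in> Q" for x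
      using near[OF that(1)] continuous_on_tendsto_compose[OF cont[OF i] near[OF that(1)] l] that(2)
      by (auto simp: tendsto_fun_iff)
    show "l i \<le> F l i"
      using conv[of "\<lambda>k. r k i"] rs[OF i] by (intro LIMSEQ_le[of "\<lambda>k. r (\<phi> k) i i"]) auto
    show "F l i \<le> l i"
      using conv[of "\<lambda>k. s k i"] rs[OF i] by (intro LIMSEQ_le[of _ _ "\<lambda>k. s (\<phi> k) i i"]) auto
  qed
  then show ?thesis by (rule that[OF l])
qed

text \<open>The Schauder projection moves points of \<open>Y\<close> by at most e into the hull of a
  finite net; read in barycentric coordinates, its composition with \<open>f\<close> is a self-map
  of a cube. The approximate fixed points accumulate at a point of the compact set \<open>Y\<close>,
  which lies in \<open>C\<close>; this lets \<open>C\<close> be an infinite-dimensional base of a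
  cone.\<close>

theorem schauder_fixed_point:
  fixes f :: "'a::real_normed_vector \<Rightarrow> 'a"
  assumes C: "convex C" "C \<noteq> {}" and f: "continuous_on C f"
    and Y: "compact Y" "Y \<subseteq> C" "f ` C \<subseteq> Y"
  obtains x where "x \<in> C" "f x = x"
proof -
  have approx: "\<exists>x\<in>C. norm (f x - x) \<le> e" if e: "e > 0" for e
  proof -
    obtain N where N: "finite N" "N \<subseteq> Y" "Y \<subseteq> (\<Union>x\<in>N. ball x e)"
      using seq_compact_imp_totally_bounded[OF compact_imp_seq_compact[OF Y(1)], rule_format, OF e]
      by (elim exE conjE)
    obtain y n where y: "bij_betw y {..<n::nat} N"
      using ex_bij_betw_nat_finite[OF N(1)] by (auto simp: atLeast0LessThan)
    have yN: "y ` {..<n} = N" using y by (simp add: bij_betw_def)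
    have yC: "y i \<in> C" if "i < n" for i
    proof -
      have "y i \<in> N" using that by (simp flip: yN)
      then show ?thesis using N(2) Y(2) by blast
    qed
    have "N \<noteq> {}" using N(3) Y(3) C(2) by auto
    then have n: "0 < n" by (auto simp flip: yN)
    define Q where "Q = Pi UNIV (\<lambda>i. if i < n then {0..1::real} else {0})"
    have Q0: "0 \<le> t i" if "t \<in> Q" for t and i :: nat
    proof -
      have "t i \<in> (if i < n then {0..1} else {0})" using that unfolding Q_def by blast
      then show ?thesis by (simp split: if_splits)
    qed
    \<comment> \<open>Convex weights on the whole cube, equal to \<open>t\<close> when \<open>t\<close> lies in the simplex.\<close>
    define wt where "wt t i = (t i + max 0 (1 - (\<Sum>j<n. t j)) / n) / max 1 (\<Sum>j<n. t j)"
      for t :: "nat \<Rightarrow> real" and i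
    define h where "h t = (\<Sum>i<n. wt t i *\<^sub>R y i)" for t
    \<comment> \<open>Schauder's weights: only nodes closer than e to the point contribute.\<close>
    define \<phi> where "\<phi> i x = max 0 (e - dist x (y i))" for i x
    define G where "G t i = \<phi> i (f (h t)) / (\<Sum>j<n. \<phi> j (f (h t)))" for t i
    have hC: "h t \<in> C" if t: "t \<in> Q" for t
      unfolding h_def
    proof (rule convex_sum[OF _ C(1)])
      have "(\<Sum>i<n. wt t i) = ((\<Sum>j<n. t j) + max 0 (1 - (\<Sum>j<n. t j))) / max 1 (\<Sum>j<n. t j)"
        using n by (simp add: wt_def sum.distrib flip: sum_divide_distrib)
      then show "(\<Sum>i<n. wt t i) = 1" by (auto simp: max_def)
      show "0 \<le> wt t i" if "i \<in> {..<n}" for i using Q0[OF t, of i] by (simp add: wt_def)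
    qed (use yC in auto)
    have pos: "0 < (\<Sum>j<n. \<phi> j x)" if "x \<in> Y" for x
    proof -
      have "x \<in> (\<Union>z\<in>y ` {..<n}. ball z e)" using N(3) that yN by blast
      then obtain i where "i < n" "dist x (y i) < e" by (auto simp: dist_commute)
      then show ?thesis by (intro sum_pos2[of _ i]) (auto simp: \<phi>_def)
    qed
    have fh: "f (h t) \<in> Y" if "t \<in> Q" for t using hC[OF that] Y(3) by blast
    have co: "continuous_on Q (\<lambda>t. t i)" for i :: nat
      by (rule continuous_on_product_then_coordinatewise) (rule continuous_on_id)
    have ch: "continuous_on Q h"
      unfolding h_def wt_def by (intro continuous_intros co) auto
    have cfh: "continuous_on Q (\<lambda>t. f (h t))"
      by (rule continuous_on_compose2[OF f ch]) (use hC in auto)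
    have "\<exists>t\<in>Q. \<forall>i<n. G t i = t i"
    proof (rule brouwer_unit_cube[of n G, folded Q_def])
      show "continuous_on Q (\<lambda>t. G t i)" if "i < n" for i
      proof -
        have "continuous_on Q (\<lambda>t. \<phi> j (f (h t)))" for j
          unfolding \<phi>_def by (intro continuous_intros cfh)
        then show ?thesis
          unfolding G_def
          by (intro continuous_intros) (use pos[OF fh] in fastforce)+
      qed
      show "G t i \<in> {0..1}" if "t \<in> Q" "i < n" for t i
      proof -
        have "\<phi> i (f (h t)) \<le> (\<Sum>j<n. \<phi> j (f (h t)))"
          using that by (intro member_le_sum) (auto simp: \<phi>_def)
        then show ?thesis using pos[OF fh[OF that(1)]] by (simp add: G_def) (simp add: \<phi>_def)
      qed
    qed auto
    then obtain t where t: "t \<in> Q" and Gt: "\<And>i. i < n \<Longrightarrow> G t i = t i" by auto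
    let ?z = "f (h t)"
    \<comment> \<open>The normalised weights sum to 1, so the fixed point of \<open>G\<close> is
      automatically in the simplex, where \<open>h\<close> is the plain convex combination of the
      nodes.\<close>
    have "(\<Sum>i<n. G t i) = 1"
      using pos[OF fh[OF t]] by (simp add: G_def flip: sum_divide_distrib)
    then have sum1: "(\<Sum>i<n. t i) = 1" using Gt by simp
    then have ht: "h t = (\<Sum>i<n. t i *\<^sub>R y i)" by (simp add: h_def wt_def)
    have "?z - h t = (\<Sum>i<n. t i *\<^sub>R (?z - y i))"
      using sum1 by (simp add: ht scaleR_diff_right sum_subtractf flip: scaleR_left.sum)
    also have "norm \<dots> \<le> (\<Sum>i<n. t i * e)"
    proof (rule sum_norm_le)
      fix i assume "i \<in> {..<n}"
      then have i: "i < n" by simp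
      have ti: "0 \<le> t i" by (rule Q0[OF t])
      show "norm (t i *\<^sub>R (?z - y i)) \<le> t i * e"
      proof (cases "t i = 0")
        case False
        then have "\<phi> i ?z \<noteq> 0" using Gt[OF i] by (auto simp: G_def)
        then have "norm (?z - y i) \<le> e" by (auto simp: \<phi>_def dist_norm max_def split: if_splits)
        then show ?thesis using ti by (simp add: mult_left_mono)
      qed simp
    qed
    also have "\<dots> = e" using sum1 by (simp flip: sum_distrib_right)
    finally show ?thesis using hC[OF t] by blast
  qed
  have "\<exists>x\<in>C. norm (f x - x) \<le> 1 / Suc k" for k by (rule approx) simp
  then obtain x where x: "\<And>k. x k \<in> C" "\<And>k. norm (f (x k) - x k) \<le> 1 / Suc k" by metis
  have "\<forall>k. f (x k) \<in> Y" using x(1) Y(3) by blast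
  then obtain l \<phi> where l: "l \<in> Y" and \<phi>: "strict_mono \<phi>" and lim: "((\<lambda>k. f (x k)) \<circ> \<phi>) \<longlonglongrightarrow> l"
    using Y(1) compact_imp_seq_compact unfolding seq_compact_def by metis
  have "(\<lambda>k. 1 / real (Suc (\<phi> k))) \<longlonglongrightarrow> 0"
    using LIMSEQ_subseq_LIMSEQ[OF LIMSEQ_inverse_real_of_nat \<phi>] by (simp add: o_def inverse_eq_divide)
  then have "(\<lambda>k. f (x (\<phi> k)) - x (\<phi> k)) \<longlonglongrightarrow> 0"
    by (rule Lim_null_comparison[rotated]) (use x(2) in auto)
  from tendsto_diff[OF lim[unfolded o_def] this] have xl: "(\<lambda>k. x (\<phi> k)) \<longlonglongrightarrow> l"
    by simp
  have lC: "l \<in> C" using l Y(2) by blast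
  have "(\<lambda>k. f (x (\<phi> k))) \<longlonglongrightarrow> f l"
    by (rule continuous_on_tendsto_compose[OF f xl lC]) (use x(1) in auto)
  then have "f l = l" using lim LIMSEQ_unique by (auto simp: o_def)
  then show ?thesis using lC that by blast
qed

section \<open>Fixed points in an annulus of a cone\<close>

text \<open>A fixed point of the split map has matching directions, which already gives
  \<open>T x + \<eta> *\<^sub>R e = m *\<^sub>R x\<close>. So \<open>inner\<close> and
  \<open>outer\<close> need only speak of such perturbed eigenvectors and fix the side of 1 on which
  the multiplier lies.\<close>

theorem cone_annulus_fixed_point:
  fixes K :: "'a::real_normed_vector set" and T :: "'a \<Rightarrow> 'a" and l p q :: "'a \<Rightarrow> real"
    and \<sigma> \<kappa> :: real
  defines "A \<equiv> {x \<in> K. q x \<le> 1 \<and> 1 \<le> p x}"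
  assumes K: "\<And>x y. x \<in> K \<Longrightarrow> y \<in> K \<Longrightarrow> x + y \<in> K"
      "\<And>c x. x \<in> K \<Longrightarrow> 0 \<le> c \<Longrightarrow> c *\<^sub>R x \<in> K"
    and l: "bounded_linear l" "\<And>x. x \<in> K \<Longrightarrow> 0 \<le> l x"
    and e: "e \<in> K" "l e = 1"
    and p: "continuous_on K p" "\<And>c x. x \<in> K \<Longrightarrow> 0 \<le> c \<Longrightarrow> p (c *\<^sub>R x) = c * p x"
    and q: "continuous_on K q" "\<And>c x. x \<in> K \<Longrightarrow> 0 \<le> c \<Longrightarrow> q (c *\<^sub>R x) = c * q x"
    and pq: "\<And>x. x \<in> K \<Longrightarrow> l x = 1 \<Longrightarrow> 0 < q x \<and> q x < p x"
    and T: "continuous_on A T" "T ` A \<subseteq> Y" "compact Y" "Y \<subseteq> K"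
    and \<kappa>: "0 < \<kappa>" "\<And>x. x \<in> A \<Longrightarrow> \<kappa> < l x"
    and inner: "\<And>x \<eta> m. x \<in> A \<Longrightarrow> p x = 1 \<Longrightarrow> 0 \<le> \<eta> \<Longrightarrow> \<eta> \<le> \<kappa> \<Longrightarrow> 0 < m \<Longrightarrow>
      T x + \<eta> *\<^sub>R e = m *\<^sub>R x \<Longrightarrow> 0 < \<sigma> * (m - 1)"
    and outer: "\<And>x \<eta> m. x \<in> A \<Longrightarrow> q x = 1 \<Longrightarrow> 0 \<le> \<eta> \<Longrightarrow> \<eta> \<le> \<kappa> \<Longrightarrow> 0 < m \<Longrightarrow>
      T x + \<eta> *\<^sub>R e = m *\<^sub>R x \<Longrightarrow> \<sigma> * (m - 1) < 0"
    and \<sigma>: "\<sigma> \<noteq> 0"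
  obtains x where "x \<in> K" "q x < 1" "1 < p x" "T x = x"
proof -
  interpret l: bounded_linear l by (rule l(1))
  define B where "B = {b \<in> K. l b = 1}"
  \<comment> \<open>In direction b the annulus is the segment of radii from 1 / p b, where p is 1,
    to 1 / q b, where q is 1; the first coordinate runs through it affinely.\<close>
  define rad where "rad z = (1 - fst z) / p (snd z) + fst z / q (snd z)" for z
  define w where "w z = rad z *\<^sub>R snd z" for z
  \<comment> \<open>The perturbation \<open>\<eta> y *\<^sub>R e\<close> allows \<open>T\<close> to vanish on the annulus; it is zero at the fixed point
    found, because there \<open>l (T x) = l x > \<kappa>\<close>.\<close>
  define \<eta> where "\<eta> y = max 0 (\<kappa> - l y)" for y
  define m where "m y = l y + \<eta> y" for y
  define g where "g y = (1 / m y) *\<^sub>R (y + \<eta> y *\<^sub>R e)" for y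
  define C where "C = {0..1::real} \<times> B"
  define F where "F z = (max 0 (min 1 (fst z + \<sigma> * (m (T (w z)) - rad z))), g (T (w z)))" for z
  have lin: "l (x + y) = l x + l y" "l (c *\<^sub>R x) = c * l x" for x y c
    by (simp_all add: l.add l.scaleR)
  have B: "b \<in> K" "l b = 1" "0 < q b" "0 < p b" "1 / p b < 1 / q b" if "b \<in> B" for b
    using pq[of b] that by (auto simp: B_def field_simps)
  have mpos: "0 < m y" for y using \<kappa>(1) by (auto simp: m_def \<eta>_def max_def)
  have gB: "g y \<in> B" if "y \<in> K" for y
    using that mpos[of y] e by (auto simp: B_def g_def lin m_def \<eta>_def intro!: K)
  have convB: "convex B"
    by (rule convexI) (auto simp: B_def lin intro!: K)
  have rad: "0 < rad z" "rad z * p (snd z) - 1 = fst z * (p (snd z) / q (snd z) - 1)"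
      "1 - rad z * q (snd z) = (1 - fst z) * (1 - q (snd z) / p (snd z))" if "z \<in> C" for z
  proof -
    have z: "fst z \<in> {0..1}" "snd z \<in> B" using that by (auto simp: C_def)
    note b = B[OF z(2)]
    have "0 < (1 - fst z) / p (snd z) + fst z / q (snd z)"
    proof (cases "fst z = 0")
      case False
      then show ?thesis using z(1) b by (intro add_nonneg_pos) auto
    qed (use b in simp)
    then show "0 < rad z" by (simp add: rad_def)
    show "rad z * p (snd z) - 1 = fst z * (p (snd z) / q (snd z) - 1)"
      "1 - rad z * q (snd z) = (1 - fst z) * (1 - q (snd z) / p (snd z))"
      using b by (simp_all add: rad_def field_simps)
  qed
  have hom: "p (w z) = rad z * p (snd z)" "q (w z) = rad z * q (snd z)" "w z \<in> K" "l (w z) = rad z"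
    if "z \<in> C" for z
    using that rad(1)[OF that] B[of "snd z"] by (auto simp: w_def C_def lin intro!: p q K)
  have ratio: "1 < p b / q b" "q b / p b < 1" if "b \<in> B" for b
    using B[OF that] by (auto simp: field_simps)
  have wA: "w z \<in> A" if "z \<in> C" for z
  proof -
    have z: "0 \<le> fst z" "fst z \<le> 1" "snd z \<in> B" using that by (auto simp: C_def)
    have "0 \<le> fst z * (p (snd z) / q (snd z) - 1)" "0 \<le> (1 - fst z) * (1 - q (snd z) / p (snd z))"
      using z ratio[OF z(3)] by (auto intro!: mult_nonneg_nonneg)
    then show ?thesis using rad[OF that] hom[OF that] by (simp add: A_def)
  qed
  have cont_b: "continuous_on C (\<lambda>z. p (snd z))" "continuous_on C (\<lambda>z. q (snd z))"
    by (rule continuous_on_compose2[OF p(1)] continuous_on_compose2[OF q(1)];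
        use B in \<open>auto simp: C_def intro!: continuous_intros\<close>)+
  have cont_rad: "continuous_on C rad"
    unfolding rad_def by (intro continuous_intros cont_b) (use B in \<open>force simp: C_def\<close>)+
  have contTw: "continuous_on C (\<lambda>z. T (w z))"
    by (rule continuous_on_compose2[OF T(1)])
      (use wA in \<open>auto simp: w_def intro!: continuous_intros cont_rad\<close>)
  have cont_l: "continuous_on S (\<lambda>x. l (f x))" if "continuous_on S f" for S :: "'b::topological_space set" and f
    by (rule l.continuous_on[OF that])
  have cont_m: "continuous_on UNIV m" and cont_g: "continuous_on UNIV g"
    using mpos unfolding g_def
    by (auto intro!: continuous_intros cont_l simp: m_def \<eta>_def less_imp_neq[THEN not_sym])
  have contF: "continuous_on C F"
    unfolding F_def
    by (intro continuous_intros cont_rad continuous_on_compose2[OF cont_m contTw]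
        continuous_on_compose2[OF cont_g contTw]) auto
  obtain z where z: "z \<in> C" and Fz: "F z = z"
  proof (rule schauder_fixed_point[OF _ _ contF, of "{0..1} \<times> g ` Y"])
    show "convex C" unfolding C_def by (intro convex_Times convB) simp
    show "C \<noteq> {}" using e by (auto simp: C_def B_def)
    show "compact ({0..1::real} \<times> g ` Y)"
      by (intro compact_Times compact_continuous_image T(3) continuous_on_subset[OF cont_g]) auto
    show "{0..1} \<times> g ` Y \<subseteq> C" using gB T(4) by (auto simp: C_def)
    have "T (w z) \<in> Y" if "z \<in> C" for z using T(2) wA[OF that] by blast
    then show "F ` C \<subseteq> {0..1} \<times> g ` Y" by (simp add: F_def image_subset_iff)
  qed
  define b where "b = snd z"
  define y where "y = T (w z)"
  have b: "b \<in> B" using z by (auto simp: b_def C_def)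
  have yK: "y \<in> K" using T(2,4) wA[OF z] by (auto simp: y_def)
  have gb: "g y = b" and clip: "fst z = max 0 (min 1 (fst z + \<sigma> * (m y - rad z)))"
    using Fz by (auto simp: F_def y_def b_def prod_eq_iff)
  have yb: "y + \<eta> y *\<^sub>R e = m y *\<^sub>R b"
    using mpos[of y] by (simp flip: gb add: g_def)
  also have "\<dots> = (m y / rad z) *\<^sub>R w z" using rad(1)[OF z] by (simp add: w_def b_def)
  finally have eigen: "T (w z) + \<eta> y *\<^sub>R e = (m y / rad z) *\<^sub>R w z" by (simp add: y_def)
  have \<eta>: "0 \<le> \<eta> y" "\<eta> y \<le> \<kappa>" using l(2)[OF yK] \<kappa>(1) by (auto simp: \<eta>_def)
  have mr: "0 < m y / rad z" using mpos rad(1)[OF z] by simp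
  have sign: "\<sigma> * (m y - rad z) = rad z * (\<sigma> * (m y / rad z - 1))"
    using rad(1)[OF z] by (simp add: field_simps)
  have z01: "0 \<le> fst z" "fst z \<le> 1" using z by (auto simp: C_def)
  \<comment> \<open>At the inner end the radial displacement before clipping is strictly positive,
    so the clipped coordinate cannot stay at 0. The outer end is symmetric.\<close>
  have "fst z \<noteq> 0"
  proof
    assume 0: "fst z = 0"
    then have "p (w z) = 1" using rad(2)[OF z] hom(1)[OF z] by simp
    from inner[OF wA[OF z] this \<eta> mr eigen] have "0 < \<sigma> * (m y - rad z)"
      using rad(1)[OF z] by (simp add: sign)
    then show False using clip 0 by auto
  qed
  moreover have "fst z \<noteq> 1"
  proof
    assume 1: "fst z = 1"
    then have "q (w z) = 1" using rad(3)[OF z] hom(2)[OF z] by simp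
    from outer[OF wA[OF z] this \<eta> mr eigen] have "\<sigma> * (m y - rad z) < 0"
      using rad(1)[OF z] by (simp add: sign mult_pos_neg)
    then show False using clip 1 by auto
  qed
  ultimately have in01: "0 < fst z" "fst z < 1" using z01 by auto
  then have "\<sigma> * (m y - rad z) = 0" using clip by (auto simp: max_def min_def split: if_splits)
  then have mr_eq: "m y = rad z" using \<sigma> by simp
  then have "\<kappa> < m y" using \<kappa>(2)[OF wA[OF z]] hom(4)[OF z] by simp
  then have "\<eta> y = 0" by (auto simp: m_def \<eta>_def max_def split: if_splits)
  then have "T (w z) = w z" using eigen mr_eq rad(1)[OF z] by simp
  moreover have "0 < fst z * (p b / q b - 1)" "0 < (1 - fst z) * (1 - q b / p b)"
    using in01 ratio[OF b] by auto
  then have "1 < p (w z)" "q (w z) < 1" using rad[OF z] hom[OF z] by (auto simp: b_def)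
  ultimately show ?thesis using hom(3)[OF z] that by blast
qed

section \<open>Integral operators on cones of continuous functions\<close>

definition clip :: "real \<Rightarrow> real" where
  "clip t = max 0 (min 1 t)"

lemma clip_01 [simp]: "clip t \<in> {0..1}" "0 \<le> clip t" "clip t \<le> 1"
  by (simp_all add: clip_def)

lemma clip_id [simp]: "t \<in> {0..1} \<Longrightarrow> clip t = t"
  by (auto simp: clip_def)

lemma clip_contracting: "\<bar>clip s - clip t\<bar> \<le> \<bar>s - t\<bar>"
  by (auto simp: clip_def max_def min_def)

text \<open>A single constant is both bound and Lipschitz constant: the kernels are bounded by 1 and
  1-Lipschitz in their first argument, so a bound for the function integrated against them provides
  both.\<close>

definition lipschitz_ball :: "real \<Rightarrow> (real \<Rightarrow>\<^sub>C real) set" where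
  "lipschitz_ball L =
     {u :: real \<Rightarrow>\<^sub>C real. (\<forall>t. u t = u (clip t)) \<and> (\<forall>t. \<bar>u t\<bar> \<le> L) \<and> (\<forall>s t. \<bar>u s - u t\<bar> \<le> L * \<bar>s - t\<bar>)}"

lemma tendsto_apply_bcontfun:
  assumes "X \<longlonglongrightarrow> (x :: real \<Rightarrow>\<^sub>C real)"
  shows "(\<lambda>n. X n t) \<longlonglongrightarrow> x t"
  by (rule tendsto_uniform_limitI[OF tendsto_bcontfun_uniform_limit[OF assms]]) simp

lemma bcontfun_clip_extension:
  fixes g :: "real \<Rightarrow> real"
  assumes g: "continuous_on {0..1} g"
  obtains x :: "real \<Rightarrow>\<^sub>C real" where "\<And>t. x t = g (clip t)"
proof -
  have "bounded (g ` {0..1})" by (rule compact_imp_bounded[OF compact_continuous_image[OF g]]) simp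
  moreover have "range (\<lambda>t. g (clip t)) \<subseteq> g ` {0..1}" using clip_01(1) by blast
  moreover have "continuous_on UNIV clip" unfolding clip_def by (intro continuous_intros)
  then have "continuous_on UNIV (\<lambda>t. g (clip t))"
    by (rule continuous_on_compose2[OF g]) auto
  ultimately have "(\<lambda>t. g (clip t)) \<in> bcontfun" unfolding bcontfun_def
    using bounded_subset by blast
  then show ?thesis using that bcontfunE by metis
qed

text \<open>Arzela-Ascoli gives a uniform limit on [0,1]. The functions and the extended limit
  depend on t only through \<open>clip t\<close>, so convergence is uniform on the line; the
  defining conditions are pointwise and survive.\<close>

lemma compact_lipschitz_ball: "compact (lipschitz_ball L)"
  unfolding compact_eq_seq_compact_metric seq_compact_def
proof (intro allI impI)
  fix X :: "nat \<Rightarrow> real \<Rightarrow>\<^sub>C real"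
  assume "\<forall>n. X n \<in> lipschitz_ball L"
  then have X: "X n t = X n (clip t)" "\<bar>X n t\<bar> \<le> L" "\<bar>X n s - X n t\<bar> \<le> L * \<bar>s - t\<bar>" for n s t
    unfolding lipschitz_ball_def by blast+
  have L0: "0 \<le> L" using X(2)[of 0 0] by linarith
  obtain g \<phi> where g: "continuous_on {0..1} g" and \<phi>: "strict_mono (\<phi> :: nat \<Rightarrow> nat)"
    and lim: "\<And>e. 0 < e \<Longrightarrow> \<exists>N. \<forall>n x. n \<ge> N \<and> x \<in> {0..1} \<longrightarrow> norm (X (\<phi> n) x - g x) < e"
  proof (rule Arzela_Ascoli[of "{0..1}" "\<lambda>n. apply_bcontfun (X n)" L])
    fix x e :: real
    assume e: "0 < e"
    \<comment> \<open>The denominator \<open>L + 1\<close> keeps the quotient meaningful when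
      \<open>L\<close> is 0.\<close>
    have "norm (X n x - X n y) < e" if "norm (x - y) < e / (L + 1)" for n y
    proof -
      have "L * \<bar>x - y\<bar> \<le> (L + 1) * \<bar>x - y\<bar>" by (simp add: mult_right_mono)
      also have "\<dots> < e" using that L0 by (simp add: field_simps)
      finally show ?thesis using X(3)[of n x y] by simp
    qed
    then show "\<exists>d>0. \<forall>n y. y \<in> {0..1} \<and> norm (x - y) < d \<longrightarrow> norm (X n x - X n y) < e"
      using e L0 by (intro exI[of _ "e / (L + 1)"]) auto
  next
    show "norm (X n x) \<le> L" if "x \<in> {0..1}" for n x using X(2) by simp
  qed (simp, rule that)
  from bcontfun_clip_extension[OF g]
  obtain x :: "real \<Rightarrow>\<^sub>C real" where x: "\<And>t. x t = g (clip t)" by blast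
  have conv: "(X \<circ> \<phi>) \<longlonglongrightarrow> x"
  proof (rule metric_LIMSEQ_I)
    fix r :: real
    assume "0 < r"
    then obtain N where N: "\<And>n t. n \<ge> N \<Longrightarrow> t \<in> {0..1} \<Longrightarrow> norm (X (\<phi> n) t - g t) < r / 2"
      using lim[of "r / 2"] by auto
    have "dist (X (\<phi> n)) x \<le> r / 2" if "n \<ge> N" for n
      by (rule dist_bound) (subst X(1), use N[OF that clip_01(1)] in \<open>simp add: x dist_norm less_imp_le\<close>)
    then show "\<exists>N. \<forall>n\<ge>N. dist ((X \<circ> \<phi>) n) x < r"
      using \<open>0 < r\<close> by (intro exI[of _ N]) fastforce
  qed
  have pt: "(\<lambda>n. X (\<phi> n) t) \<longlonglongrightarrow> x t" for t
    using tendsto_apply_bcontfun[OF conv] by simp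
  have "x \<in> lipschitz_ball L"
    unfolding lipschitz_ball_def mem_Collect_eq
  proof (intro conjI allI)
    show "x t = x (clip t)" for t by (simp add: x)
    show "\<bar>x t\<bar> \<le> L" for t
      by (rule LIMSEQ_le_const2[OF tendsto_rabs[OF pt]]) (use X(2) in blast)
    show "\<bar>x s - x t\<bar> \<le> L * \<bar>s - t\<bar>" for s t
      by (rule LIMSEQ_le_const2[OF tendsto_rabs[OF tendsto_diff[OF pt pt]]]) (use X(3) in blast)
  qed
  then show "\<exists>l\<in>lipschitz_ball L. \<exists>r. strict_mono r \<and> (X \<circ> r) \<longlonglongrightarrow> l"
    using \<phi> conv by blast
qed

section \<open>Minima over a subinterval and the cone of extended functions\<close>

definition min_on :: "real \<Rightarrow> real \<Rightarrow> (real \<Rightarrow>\<^sub>C real) \<Rightarrow> real" where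
  "min_on a b u = (INF t\<in>{a..b}. u t)"

lemma min_on_attained:
  fixes u :: "real \<Rightarrow>\<^sub>C real"
  assumes "a \<le> b"
  shows "\<exists>t\<in>{a..b}. u t = min_on a b u" "\<And>t. t \<in> {a..b} \<Longrightarrow> min_on a b u \<le> u t"
proof -
  obtain t where t: "t \<in> {a..b}" "\<And>s. s \<in> {a..b} \<Longrightarrow> u t \<le> u s"
    using continuous_attains_inf[of "{a..b}" "apply_bcontfun u"] assms by auto
  have "min_on a b u = u t"
    unfolding min_on_def by (rule cInf_eq_minimum) (use t in auto)
  then show "\<exists>t\<in>{a..b}. u t = min_on a b u" "\<And>t. t \<in> {a..b} \<Longrightarrow> min_on a b u \<le> u t"
    using t by auto
qed

lemma min_on_scaleR:
  assumes "a \<le> b" "0 \<le> c"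
  shows "min_on a b (c *\<^sub>R u) = c * min_on a b u"
proof -
  obtain t where "t \<in> {a..b}" "u t = min_on a b u" using min_on_attained(1)[OF assms(1)] by blast
  moreover obtain s where "s \<in> {a..b}" "(c *\<^sub>R u) s = min_on a b (c *\<^sub>R u)"
    using min_on_attained(1)[OF assms(1)] by blast
  ultimately show ?thesis
    using min_on_attained(2)[OF assms(1), of t "c *\<^sub>R u"] min_on_attained(2)[OF assms(1), of s u]
      mult_left_mono[OF _ assms(2), of "min_on a b u" "u s"] by force
qed

lemma min_on_le_norm:
  assumes "a \<le> b"
  shows "min_on a b u \<le> norm u"
proof -
  obtain t where "u t = min_on a b u" using min_on_attained(1)[OF assms] by blast
  then show ?thesis using norm_bounded[of u t] by simp
qed

lemma continuous_on_min_on: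
  assumes "a \<le> b"
  shows "continuous_on S (min_on a b)"
proof -
  have le: "min_on a b u \<le> min_on a b v + dist u v" for u v
  proof -
    obtain t where "t \<in> {a..b}" "v t = min_on a b v" using min_on_attained(1)[OF assms] by blast
    then show ?thesis
      using min_on_attained(2)[OF assms, of t u] dist_bounded[of u t v] by (simp add: dist_norm)
  qed
  have "dist (min_on a b u) (min_on a b v) \<le> dist u v" for u v
    using le[of u v] le[of v u] by (simp add: dist_real_def dist_commute)
  then show ?thesis unfolding continuous_on_iff by (meson le_less_trans)
qed

text \<open>Continuous functions on \<open>[0,1]\<close> are represented by their extensions to the real line that are
  constant on either side of \<open>[0,1]\<close>; this makes the cone a subset of a normed space type.\<close>

definition ext_cone :: "real \<Rightarrow> real \<Rightarrow> real \<Rightarrow> (real \<Rightarrow>\<^sub>C real) set" where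
  "ext_cone a b c =
     {u :: real \<Rightarrow>\<^sub>C real. (\<forall>t. u t = u (clip t)) \<and> (\<forall>t. 0 \<le> u t) \<and> (\<forall>t\<in>{a..b}. \<forall>s. c * u s \<le> u t)}"

lemma ext_coneD:
  assumes "u \<in> ext_cone a b c"
  shows "u t = u (clip t)" "0 \<le> u t" "t \<in> {a..b} \<Longrightarrow> c * u s \<le> u t"
  using assms unfolding ext_cone_def by blast+

lemma ext_cone_add: "u \<in> ext_cone a b c \<Longrightarrow> v \<in> ext_cone a b c \<Longrightarrow> u + v \<in> ext_cone a b c"
  by (auto simp: ext_cone_def distrib_left intro!: add_mono)

lemma ext_cone_scaleR: "u \<in> ext_cone a b c \<Longrightarrow> 0 \<le> r \<Longrightarrow> r *\<^sub>R u \<in> ext_cone a b c"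
  by (auto simp: ext_cone_def mult.left_commute[of c] intro!: mult_left_mono)

lemma ext_cone_const: "0 \<le> x \<Longrightarrow> c \<le> 1 \<Longrightarrow> const_bcontfun x \<in> ext_cone a b c"
  by (simp add: ext_cone_def mult_right_mono[of c 1 x, simplified])

lemma closed_ext_cone: "closed (ext_cone a b c)"
  unfolding closed_sequential_limits
proof (intro allI impI, elim conjE)
  fix X x
  assume X: "\<forall>n. X n \<in> ext_cone a b c" and "X \<longlonglongrightarrow> x"
  note pt = tendsto_apply_bcontfun[OF this(2)]
  note X = ext_coneD[OF X[rule_format]]
  show "x \<in> ext_cone a b c"
    unfolding ext_cone_def mem_Collect_eq
  proof (intro conjI allI ballI)
    show "x t = x (clip t)" for t
      by (rule LIMSEQ_unique[OF pt]) (use X(1)[of _ t] pt[of "clip t"] in simp)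
    show "0 \<le> x t" for t
      by (rule LIMSEQ_le_const[OF pt]) (use X(2) in blast)
    show "c * x s \<le> x t" if "t \<in> {a..b}" for s t
      by (rule LIMSEQ_le[OF tendsto_mult_left[OF pt] pt]) (use X(3)[OF that] in blast)
  qed
qed

text \<open>The cone is defined by comparing values pointwise, which makes sums, multiples and
  limits immediate. Bounding all values at once recovers the norm inequality of the original
  cone.\<close>

lemma ext_cone_norm:
  assumes "u \<in> ext_cone a b c" "0 < c"
  shows "t \<in> {a..b} \<Longrightarrow> c * norm u \<le> u t" "a \<le> b \<Longrightarrow> c * norm u \<le> min_on a b u"
proof -
  show le: "c * norm u \<le> u t" if "t \<in> {a..b}" for t
  proof -
    have "norm u \<le> u t / c"
      by (rule norm_bound)
        (use ext_coneD(2)[OF assms(1)] ext_coneD(3)[OF assms(1) that] assms(2) in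
          \<open>simp add: field_simps\<close>)
    then show ?thesis using assms(2) by (simp add: field_simps)
  qed
  show "a \<le> b \<Longrightarrow> c * norm u \<le> min_on a b u" using le min_on_attained(1)[of a b u] by metis
qed

section \<open>Integral operators with a kernel adapted to the cone\<close>

text \<open>The bound and the Lipschitz condition yield compactness, \<open>k_cone\<close>
  integrates to the cone inequality, and \<open>k_pos\<close> keeps the infimum behind
  \<open>M_of\<close> away from 0.\<close>

locale cone_kernel =
  fixes k :: "real \<Rightarrow> real \<Rightarrow> real" and a b c :: real
  assumes ab: "0 \<le> a" "a < b" "b \<le> 1" and c: "0 < c" "c \<le> 1"
    and k_cont: "\<And>t. t \<in> {0..1} \<Longrightarrow> continuous_on {0..1} (k t)"
    and k_01: "\<And>t s. t \<in> {0..1} \<Longrightarrow> s \<in> {0..1} \<Longrightarrow> k t s \<in> {0..1}"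
    and k_lipschitz: "\<And>t t' s. t \<in> {0..1} \<Longrightarrow> t' \<in> {0..1} \<Longrightarrow> s \<in> {0..1} \<Longrightarrow>
      \<bar>k t s - k t' s\<bar> \<le> \<bar>t - t'\<bar>"
    and k_cone: "\<And>t t' s. t \<in> {a..b} \<Longrightarrow> t' \<in> {0..1} \<Longrightarrow> s \<in> {0..1} \<Longrightarrow> c * k t' s \<le> k t s"
    and k_pos: "\<exists>d>0. \<forall>t\<in>{a..b}. \<forall>s\<in>{a..b}. d \<le> k t s"
begin

text \<open>The nonlinearity is left to the argument \<open>g\<close>, so this operator is linear in
  \<open>g\<close>. For continuous \<open>g\<close> the function under \<open>Bcontfun\<close> is
  bounded and continuous, as the proof of \<open>hammerstein_apply\<close> shows.\<close>

definition hammerstein :: "(real \<Rightarrow> real) \<Rightarrow> real \<Rightarrow>\<^sub>C real" where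
  "hammerstein g = Bcontfun (\<lambda>t. integral {0..1} (\<lambda>s. k (clip t) s * g s))"

lemma integrable_kernel_mult:
  assumes "continuous_on {0..1} g" "t \<in> {0..1}" "{x..y} \<subseteq> {0..1}"
  shows "(\<lambda>s. k t s * g s) integrable_on {x..y}"
  using assms by (intro integrable_continuous_real continuous_on_mult continuous_on_subset[OF k_cont]
      continuous_on_subset[OF assms(1)]) auto

lemma integral_kernel_lipschitz:
  assumes g: "continuous_on {0..1} g" "\<And>s. s \<in> {0..1} \<Longrightarrow> \<bar>g s\<bar> \<le> G"
    and t: "t \<in> {0..1}" "t' \<in> {0..1}"
  shows "\<bar>integral {0..1} (\<lambda>s. k t s * g s) - integral {0..1} (\<lambda>s. k t' s * g s)\<bar> \<le> G * \<bar>t - t'\<bar>"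
proof -
  have "norm (integral {0..1} (\<lambda>s. k t s * g s - k t' s * g s)) \<le> integral {0..1} (\<lambda>s::real. G * \<bar>t - t'\<bar>)"
  proof (rule integral_norm_bound_integral)
    fix s :: real
    assume s: "s \<in> {0..1}"
    have "\<bar>g s\<bar> * \<bar>k t s - k t' s\<bar> \<le> G * \<bar>t - t'\<bar>"
      by (rule mult_mono) (use g(2)[OF s] k_lipschitz[OF t s] in auto)
    then show "norm (k t s * g s - k t' s * g s) \<le> G * \<bar>t - t'\<bar>"
      
      by (simp add: mult.commute[of _ "g s"] flip: right_diff_distrib abs_mult)
  qed (use g t in \<open>auto intro!: integrable_diff integrable_kernel_mult\<close>)
  then show ?thesis
    using g(1) t by (simp add: integral_diff integrable_kernel_mult)
qed

lemma hammerstein_apply: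
  assumes g: "continuous_on {0..1} g"
  shows "hammerstein g t = integral {0..1} (\<lambda>s. k (clip t) s * g s)"
proof -
  have "bounded (g ` {0..1})" by (rule compact_imp_bounded[OF compact_continuous_image[OF g]]) simp
  then obtain G where G: "0 < G" "\<And>s. s \<in> {0..1} \<Longrightarrow> \<bar>g s\<bar> \<le> G"
    unfolding bounded_pos by auto
  have "continuous_on {0..1} (\<lambda>t. integral {0..1} (\<lambda>s. k t s * g s))"
    unfolding continuous_on_iff dist_real_def
  proof (intro ballI allI impI)
    fix t e :: real
    assume t: "t \<in> {0..1}" and e: "0 < e"
    show "\<exists>d>0. \<forall>t'\<in>{0..1}. \<bar>t' - t\<bar> < d \<longrightarrow>
        \<bar>integral {0..1} (\<lambda>s. k t' s * g s) - integral {0..1} (\<lambda>s. k t s * g s)\<bar> < e"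
    proof (intro exI[of _ "e / G"] conjI ballI impI)
      fix t' :: real
      assume t': "t' \<in> {0..1}" "\<bar>t' - t\<bar> < e / G"
      have "G * \<bar>t' - t\<bar> < e" using t'(2) G(1) by (simp add: field_simps)
      then show "\<bar>integral {0..1} (\<lambda>s. k t' s * g s) - integral {0..1} (\<lambda>s. k t s * g s)\<bar> < e"
        using integral_kernel_lipschitz[OF g G(2) t'(1) t] by linarith
    qed (use e G in simp)
  qed
  from bcontfun_clip_extension[OF this]
  obtain x :: "real \<Rightarrow>\<^sub>C real" where x: "\<And>t. x t = integral {0..1} (\<lambda>s. k (clip t) s * g s)"
    by blast
  then have "(\<lambda>t. integral {0..1} (\<lambda>s. k (clip t) s * g s)) = apply_bcontfun x" by auto
  then have "hammerstein g = x" by (simp add: hammerstein_def apply_bcontfun_inverse)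
  then show ?thesis by (simp add: x)
qed

lemma hammerstein_lipschitz_ball:
  assumes g: "continuous_on {0..1} g" "\<And>s. s \<in> {0..1} \<Longrightarrow> \<bar>g s\<bar> \<le> G"
  shows "hammerstein g \<in> lipschitz_ball G"
  unfolding lipschitz_ball_def mem_Collect_eq
proof (intro conjI allI)
  have G0: "0 \<le> G" using g(2)[of 0] by simp
  show "hammerstein g t = hammerstein g (clip t)" for t
    by (simp add: hammerstein_apply[OF g(1)])
  show "\<bar>hammerstein g t\<bar> \<le> G" for t
  proof -
    have "norm (integral {0..1} (\<lambda>s. k (clip t) s * g s)) \<le> integral {0..1} (\<lambda>s::real. G)"
    proof (rule integral_norm_bound_integral)
      fix s :: real
      assume s: "s \<in> {0..1}"
      have "\<bar>k (clip t) s\<bar> * \<bar>g s\<bar> \<le> 1 * G"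
        by (rule mult_mono) (use g(2)[OF s] k_01[OF clip_01(1) s, of t] in auto)
      then show "norm (k (clip t) s * g s) \<le> G" by (simp add: abs_mult)
    qed (use g(1) in \<open>auto intro!: integrable_kernel_mult\<close>)
    then show ?thesis by (simp add: hammerstein_apply[OF g(1)])
  qed
  show "\<bar>hammerstein g s - hammerstein g t\<bar> \<le> G * \<bar>s - t\<bar>" for s t
    using integral_kernel_lipschitz[OF g clip_01(1) clip_01(1), of s t]
      mult_left_mono[OF clip_contracting G0, of s t] by (simp add: hammerstein_apply[OF g(1)])
qed

text \<open>Linearity reduces this to the bound for \<open>g - h\<close>; the operator has norm at
  most 1 because the kernel does not exceed 1.\<close>

lemma dist_hammerstein:
  assumes g: "continuous_on {0..1} g" and h: "continuous_on {0..1} h"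
    and e: "\<And>s. s \<in> {0..1} \<Longrightarrow> \<bar>g s - h s\<bar> \<le> e"
  shows "dist (hammerstein g) (hammerstein h) \<le> e"
proof (rule dist_bound)
  fix t
  have gh: "continuous_on {0..1} (\<lambda>s. g s - h s)" by (intro continuous_intros g h)
  have "hammerstein g t - hammerstein h t = hammerstein (\<lambda>s. g s - h s) t"
    by (simp add: hammerstein_apply g h gh right_diff_distrib integral_diff integrable_kernel_mult)
  then show "dist (hammerstein g t) (hammerstein h t) \<le> e"
    using hammerstein_lipschitz_ball[OF gh e] by (simp add: lipschitz_ball_def dist_real_def)
qed

lemma hammerstein_in_cone:
  assumes g: "continuous_on {0..1} g" "\<And>s. s \<in> {0..1} \<Longrightarrow> 0 \<le> g s"
  shows "hammerstein g \<in> ext_cone a b c"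
  unfolding ext_cone_def mem_Collect_eq
proof (intro conjI allI ballI)
  show "hammerstein g t = hammerstein g (clip t)" for t
    by (simp add: hammerstein_apply[OF g(1)])
  have k0: "0 \<le> k (clip t) s" if "s \<in> {0..1}" for t s using k_01[OF clip_01(1) that] by auto
  show "0 \<le> hammerstein g t" for t
    unfolding hammerstein_apply[OF g(1)]
    by (rule integral_nonneg) (use g k0 in \<open>auto intro!: integrable_kernel_mult\<close>)
  show "c * hammerstein g r \<le> hammerstein g t" if t: "t \<in> {a..b}" for t r
  proof -
    have t1: "t \<in> {0..1}" using t ab by auto
    have "integral {0..1} (\<lambda>s. c * (k (clip r) s * g s)) \<le> integral {0..1} (\<lambda>s. k t s * g s)"
    proof (rule integral_le)
      fix s :: real
      assume s: "s \<in> {0..1}"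
      show "c * (k (clip r) s * g s) \<le> k t s * g s"
        using mult_right_mono[OF k_cone[OF t clip_01(1) s] g(2)[OF s]] by (simp add: mult.assoc)
    qed (use g(1) t1 in \<open>auto intro!: integrable_kernel_mult integrable_on_mult_right\<close>)
    then show ?thesis using t1 by (simp add: hammerstein_apply[OF g(1)])
  qed
qed

lemma hammerstein_le:
  assumes g: "continuous_on {0..1} g" "\<And>s. s \<in> {0..1} \<Longrightarrow> g s \<le> G" and G: "0 \<le> G"
  shows "hammerstein g t \<le> G / m_of k"
proof -
  have one: "continuous_on {0..1} (\<lambda>s::real. 1::real)" by simp
  have int: "k t integrable_on {0..1}" if "t \<in> {0..1}" for t
    using integrable_kernel_mult[OF one that, of 0 1] by simp
  have "integral {0..1} (k t) \<le> 1" if "t \<in> {0..1}" for t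
    using integral_le[OF int[OF that], of "\<lambda>s. 1"] k_01[OF that] by auto
  then have "bdd_above ((\<lambda>t. integral {0..1} (k t)) ` {0..1})" by (intro bdd_aboveI2)
  then have "integral {0..1} (k (clip t)) \<le> (SUP t\<in>{0..1}. integral {0..1} (k t))"
    by (rule cSUP_upper[OF clip_01(1)])
  \<comment> \<open>A double reciprocal is the identity, also at 0 by the convention for
    division.\<close>
  then have sup: "integral {0..1} (k (clip t)) \<le> 1 / m_of k" by (simp add: m_of_def)
  have "integral {0..1} (\<lambda>s. k (clip t) s * g s) \<le> integral {0..1} (\<lambda>s. k (clip t) s * G)"
    by (rule integral_le) (use g k_01[OF clip_01(1), of _ t] int[OF clip_01(1), of t] in
        \<open>auto intro!: integrable_kernel_mult mult_left_mono integrable_on_mult_left\<close>)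
  also have "\<dots> \<le> (1 / m_of k) * G" using mult_right_mono[OF sup G] by simp
  finally show ?thesis by (simp add: hammerstein_apply[OF g(1)])
qed

text \<open>The integrals over [a,b] are at least d (b - a), uniformly in t. This makes the infimum
  positive, hence also its reciprocal, and bounds the family below so that the infimum is a lower
  bound. The part of the integral outside [a,b] is nonnegative and is dropped.\<close>

lemma M_of_pos: "0 < M_of k a b"
  and hammerstein_ge: "\<lbrakk>continuous_on {0..1} g; \<And>s. s \<in> {0..1} \<Longrightarrow> 0 \<le> g s;
    \<And>s. s \<in> {a..b} \<Longrightarrow> G \<le> g s; 0 \<le> G; t \<in> {a..b}\<rbrakk> \<Longrightarrow> G / M_of k a b \<le> hammerstein g t"
proof -
  obtain d where d: "d > 0" "\<And>t s. t \<in> {a..b} \<Longrightarrow> s \<in> {a..b} \<Longrightarrow> d \<le> k t s"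
    using k_pos by blast
  have sub: "{a..b} \<subseteq> {0..1}" using ab by auto
  have one: "continuous_on {0..1} (\<lambda>s::real. 1::real)" by simp
  have int: "k t integrable_on {a..b}" if "t \<in> {a..b}" for t
    using integrable_kernel_mult[OF one _ sub, of t] that sub by auto
  have low: "d * (b - a) \<le> integral {a..b} (k t)" if "t \<in> {a..b}" for t
    using integral_le[OF _ int[OF that], of "\<lambda>s. d"] d(2)[OF that] ab(2) by (auto simp: mult.commute)
  have "d * (b - a) \<le> (INF t\<in>{a..b}. integral {a..b} (k t))"
    by (rule cINF_greatest) (use low ab in auto)
  moreover have "0 < d * (b - a)" using d ab by simp
  ultimately show "0 < M_of k a b" by (simp add: M_of_def)
  assume g: "continuous_on {0..1} g" "\<And>s. s \<in> {0..1} \<Longrightarrow> 0 \<le> g s"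
      "\<And>s. s \<in> {a..b} \<Longrightarrow> G \<le> g s" and G: "0 \<le> G" and t: "t \<in> {a..b}"
  have t1: "t \<in> {0..1}" using t sub by blast
  have "bdd_below ((\<lambda>t. integral {a..b} (k t)) ` {a..b})" by (rule bdd_belowI2) (use low in blast)
  then have "(INF t\<in>{a..b}. integral {a..b} (k t)) \<le> integral {a..b} (k t)"
    by (rule cINF_lower) (use t in auto)
  then have "1 / M_of k a b \<le> integral {a..b} (k t)" by (simp add: M_of_def)
  from mult_right_mono[OF this G]
  have "(1 / M_of k a b) * G \<le> integral {a..b} (\<lambda>s. k t s * G)" by simp
  also have "\<dots> \<le> integral {a..b} (\<lambda>s. k t s * g s)"
  proof (rule integral_le)
    show "k t s * G \<le> k t s * g s" if "s \<in> {a..b}" for s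
      using g(3)[OF that] d(1) d(2)[OF t that] by (simp add: mult_left_mono)
  qed (use g(1) t1 sub int[OF t] in \<open>auto intro!: integrable_kernel_mult integrable_on_mult_left\<close>)
  also have "\<dots> \<le> integral {0..1} (\<lambda>s. k t s * g s)"
    by (rule integral_subset_le) (use g t1 sub k_01[OF t1] in \<open>auto intro!: integrable_kernel_mult\<close>)
  finally show "G / M_of k a b \<le> hammerstein g t" using t1 by (simp add: hammerstein_apply[OF g(1)])
qed

end

section \<open>The two kernels: Green's functions of -u'' with u(0) = u(1) = 0 and with u(0) = u'(1)
  = 0\<close>

lemma kern1_min: "kern1 t s = min (s * (1 - t)) (t * (1 - s))"
  by (auto simp: kern1_def min_def algebra_simps)

lemma kern2_min: "kern2 t s = min s t"
  by (auto simp: kern2_def)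

lemma kern1_le:
  assumes "t \<in> {0..1}" "s \<in> {0..1}"
  shows "kern1 t s \<le> s" "kern1 t s \<le> 1 - s" "0 \<le> kern1 t s"
  using assms mult_left_mono[of "1 - t" 1 s] mult_right_mono[of t 1 "1 - s"]
  by (auto simp: kern1_min min_def intro!: mult_nonneg_nonneg)

lemma kern1_lipschitz:
  assumes "t \<in> {0..1}" "t' \<in> {0..1}" "s \<in> {0..1}"
  shows "\<bar>kern1 t s - kern1 t' s\<bar> \<le> \<bar>t - t'\<bar>"
proof -
  have *: "\<bar>kern1 t s - kern1 t' s\<bar> \<le> \<bar>t - t'\<bar>"
    if "t' \<le> t" "t \<in> {0..1}" "t' \<in> {0..1}" for t t' :: real
  proof -
    have "0 \<le> s * (t - t')" "s * (t - t') \<le> t - t'"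
      using that assms(3) mult_right_mono[of s 1 "t - t'"] by auto
    then show ?thesis
      using that by (auto simp: kern1_def abs_if algebra_simps)
  qed
  show ?thesis
    using *[of t' t] *[of t t'] assms by (cases "t' \<le> t") (auto simp: abs_minus_commute)
qed

interpretation k1: cone_kernel kern1 a1 b1 c1
proof
  show "0 \<le> a1" "a1 < b1" "b1 \<le> 1" "0 < c1" "c1 \<le> 1"
    by (simp_all add: a1_def b1_def c1_def)
  show "continuous_on {0..1} (kern1 t)" for t
    unfolding kern1_min[abs_def] by (intro continuous_intros)
  show "kern1 t s \<in> {0..1}" if "t \<in> {0..1}" "s \<in> {0..1}" for t s
    using kern1_le[OF that] that by auto
  show "\<bar>kern1 t s - kern1 t' s\<bar> \<le> \<bar>t - t'\<bar>" if "t \<in> {0..1}" "t' \<in> {0..1}" "s \<in> {0..1}" for t t' s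
    by (rule kern1_lipschitz[OF that])
  show "c1 * kern1 t' s \<le> kern1 t s" if "t \<in> {a1..b1}" "t' \<in> {0..1}" "s \<in> {0..1}" for t t' s
  proof -
    \<comment> \<open>This is the origin of \<open>c1\<close>: on [1/4,3/4] both t and 1 - t are at
      least 1/4, while the kernel never exceeds the minimum of s and 1 - s.\<close>
    have "1/4 * s \<le> (1 - t) * s" "1/4 * (1 - s) \<le> t * (1 - s)"
      using that mult_right_mono[of "1/4" "1 - t" s] mult_right_mono[of "1/4" t "1 - s"]
      by (auto simp: a1_def b1_def)
    then show ?thesis
      using kern1_le[OF that(2,3)] by (auto simp: kern1_min c1_def mult.commute)
  qed
  show "\<exists>d>0. \<forall>t\<in>{a1..b1}. \<forall>s\<in>{a1..b1}. d \<le> kern1 t s"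
  proof (intro exI[of _ "1/4 * (1/4)"] conjI ballI)
    fix t s
    assume "t \<in> {a1..b1}" "s \<in> {a1..b1}"
    then have "1/4 * (1/4) \<le> s * (1 - t)" "1/4 * (1/4) \<le> t * (1 - s)"
      by (intro mult_mono; simp add: a1_def b1_def)+
    then show "1/4 * (1/4) \<le> kern1 t s" by (simp add: kern1_min)
  qed simp
qed

interpretation k2: cone_kernel kern2 a2 b2 c2
proof
  show "0 \<le> a2" "a2 < b2" "b2 \<le> 1" "0 < c2" "c2 \<le> 1"
    by (simp_all add: a2_def b2_def c2_def)
  show "continuous_on {0..1} (kern2 t)" for t
    unfolding kern2_min[abs_def] by (intro continuous_intros)
  show "\<exists>d>0. \<forall>t\<in>{a2..b2}. \<forall>s\<in>{a2..b2}. d \<le> kern2 t s"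
    by (intro exI[of _ "1/2"]) (auto simp: kern2_min a2_def)
\<comment> \<open>The cone inequality with \<open>c2 = 1/2\<close> holds because t \<ge> 1/2 and s
  \<le> 1 make the minimum of s and t at least s/2.\<close>
qed (auto simp: kern2_min a2_def b2_def c2_def min_def)

section \<open>Nonlinear operators obtained by superposition\<close>

type_synonym bcont_pair = "(real \<Rightarrow>\<^sub>C real) \<times> (real \<Rightarrow>\<^sub>C real)"

definition pair_box :: "real \<Rightarrow> bcont_pair set" where
  "pair_box R =
     {w. \<forall>s. (apply_bcontfun (fst w) s, apply_bcontfun (snd w) s) \<in> {0..R} \<times> {0..R}}"

abbreviation superpose :: "(real \<times> real \<Rightarrow> real) \<Rightarrow> bcont_pair \<Rightarrow> real \<Rightarrow> real" where
  "superpose f w \<equiv> \<lambda>s. f (apply_bcontfun (fst w) s, apply_bcontfun (snd w) s)"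

context cone_kernel
begin

text \<open>On the compact square \<open>f\<close> is uniformly continuous, so uniformly close pairs
  give uniformly close integrands; it is also bounded there, which gives one Lipschitz ball for the
  whole box.\<close>

lemma continuous_on_hammerstein_superposition:
  fixes f :: "real \<times> real \<Rightarrow> real" and R :: real
  assumes f: "continuous_on ({0..R} \<times> {0..R}) f"
  shows "continuous_on (pair_box R) (\<lambda>w. hammerstein (superpose f w))"
    and "\<exists>L. \<forall>w\<in>pair_box R. hammerstein (superpose f w) \<in> lipschitz_ball L"
proof -
  have comp: "compact ({0..R} \<times> {0..R})" by (intro compact_Times) auto
  have cont: "continuous_on {0..1} (superpose f w)" if "w \<in> pair_box R" for w
    by (rule continuous_on_compose2[OF f])
      (use that in \<open>auto simp: pair_box_def intro!: continuous_intros\<close>)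
  show "continuous_on (pair_box R) (\<lambda>w. hammerstein (superpose f w))"
    unfolding continuous_on_iff
  proof (intro ballI allI impI)
    fix w and e :: real
    assume w: "w \<in> pair_box R" and "0 < e"
    obtain d where d: "0 < d" "\<And>x y. x \<in> {0..R} \<times> {0..R} \<Longrightarrow> y \<in> {0..R} \<times> {0..R} \<Longrightarrow> dist y x < d \<Longrightarrow>
        dist (f y) (f x) < e / 2"
      using compact_uniformly_continuous[OF f comp] \<open>0 < e\<close> unfolding uniformly_continuous_on_def
      by (meson half_gt_zero)
    have "dist (hammerstein (superpose f w')) (hammerstein (superpose f w)) \<le> e / 2"
      if w': "w' \<in> pair_box R" "dist w' w < d" for w'
    proof (rule dist_hammerstein[OF cont[OF w'(1)] cont[OF w]])
      fix s
      have "dist (fst w' s, snd w' s) (fst w s, snd w s) \<le> dist w' w"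
        unfolding dist_prod_def
        by (intro real_sqrt_le_mono add_mono power_mono) (auto simp: dist_bounded)
      then have "dist (f (fst w' s, snd w' s)) (f (fst w s, snd w s)) < e / 2"
        using d(2)[of "(fst w s, snd w s)" "(fst w' s, snd w' s)"] w w' by (force simp: pair_box_def)
      then show "\<bar>f (fst w' s, snd w' s) - f (fst w s, snd w s)\<bar> \<le> e / 2"
        by (simp add: dist_real_def)
    qed
    then show "\<exists>d>0. \<forall>w'\<in>pair_box R. dist w' w < d \<longrightarrow>
        dist (hammerstein (superpose f w')) (hammerstein (superpose f w)) < e"
      using \<open>0 < e\<close> d(1) by (intro exI[of _ d]) fastforce
  qed
  obtain L where "\<And>x. x \<in> {0..R} \<times> {0..R} \<Longrightarrow> \<bar>f x\<bar> \<le> L"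
    using compact_imp_bounded[OF compact_continuous_image[OF f comp]] unfolding bounded_iff
    by auto
  then have "hammerstein (superpose f w) \<in> lipschitz_ball L" if "w \<in> pair_box R" for w
    by (intro hammerstein_lipschitz_ball cont[OF that]) (use that in \<open>force simp: pair_box_def\<close>)
  then show "\<exists>L. \<forall>w\<in>pair_box R. hammerstein (superpose f w) \<in> lipschitz_ball L" by blast
qed

text \<open>The strict inequality for the supremum leaves a margin independent of the functions; it
  will absorb the perturbation of the operator.\<close>

lemma hammerstein_superposition_less:
  fixes f :: "real \<times> real \<Rightarrow> real" and \<rho> :: real
  assumes f: "continuous_on ({0..\<rho>} \<times> {0..\<rho>}) f" "\<And>p. p \<in> {0..\<rho>} \<times> {0..\<rho>} \<Longrightarrow> 0 \<le> f p"
    and \<rho>: "0 < \<rho>" and sup: "(SUP p\<in>{0..\<rho>} \<times> {0..\<rho>}. f p / \<rho>) < m_of k"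
  obtains \<delta> where "0 < \<delta>" "\<And>u v t. continuous_on {0..1} u \<Longrightarrow> continuous_on {0..1} v \<Longrightarrow>
    (\<And>s. s \<in> {0..1} \<Longrightarrow> (u s, v s) \<in> {0..\<rho>} \<times> {0..\<rho>}) \<Longrightarrow>
    hammerstein (\<lambda>s. f (u s, v s)) t \<le> \<rho> - \<delta>"
proof -
  define S where "S = (SUP p\<in>{0..\<rho>} \<times> {0..\<rho>}. f p / \<rho>)"
  have "continuous_on ({0..\<rho>} \<times> {0..\<rho>}) (\<lambda>p. f p / \<rho>)"
    using \<rho> by (intro continuous_intros f) auto
  then have "compact ((\<lambda>p. f p / \<rho>) ` ({0..\<rho>} \<times> {0..\<rho>}))"
    by (intro compact_continuous_image compact_Times) auto
  then have bdd: "bdd_above ((\<lambda>p. f p / \<rho>) ` ({0..\<rho>} \<times> {0..\<rho>}))"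
    by (intro bounded_imp_bdd_above compact_imp_bounded)
  have S: "f p / \<rho> \<le> S" if "p \<in> {0..\<rho>} \<times> {0..\<rho>}" for p
    unfolding S_def by (rule cSUP_upper[OF that bdd])
  have zero: "(0, 0) \<in> {0..\<rho>} \<times> {0..\<rho>}" using \<rho> by simp
  \<comment> \<open>Together with \<open>S < m_of k\<close> this makes \<open>m_of k\<close>
    positive, so dividing by it preserves the inequality.\<close>
  have S0: "0 \<le> S"
    using S[OF zero] f(2)[OF zero] \<rho> by (meson divide_nonneg_pos order_trans)
  have "S * \<rho> < m_of k * \<rho>" using sup \<rho> by (simp add: S_def)
  then have \<delta>: "0 < \<rho> - S * \<rho> / m_of k" using sup S0 by (simp add: S_def field_simps)
  have "hammerstein (\<lambda>s. f (u s, v s)) t \<le> \<rho> - (\<rho> - S * \<rho> / m_of k)"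
    if "continuous_on {0..1} u" "continuous_on {0..1} v"
      and uv: "\<And>s. s \<in> {0..1} \<Longrightarrow> (u s, v s) \<in> {0..\<rho>} \<times> {0..\<rho>}" for u v t
  proof -
    have "hammerstein (\<lambda>s. f (u s, v s)) t \<le> S * \<rho> / m_of k"
    proof (rule hammerstein_le)
      show "continuous_on {0..1} (\<lambda>s. f (u s, v s))"
        by (rule continuous_on_compose2[OF f(1)]) (use that in \<open>auto intro!: continuous_intros\<close>)
      show "f (u s, v s) \<le> S * \<rho>" if "s \<in> {0..1}" for s
        using S[OF uv[OF that]] \<rho> by (simp add: field_simps)
      show "0 \<le> S * \<rho>" using S0 \<rho> by simp
    qed
    then show ?thesis by simp
  qed
  then show ?thesis by (rule that[OF \<delta>])
qed

text \<open>The region \<open>P\<close> is left open so that one statement serves the different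
  rectangles of I0 and of its starred form. A pointwise strict inequality suffices, since the
  perturbation only adds to the values.\<close>

lemma hammerstein_superposition_greater:
  fixes f :: "real \<times> real \<Rightarrow> real" and \<rho> :: real
  assumes f: "continuous_on ({0..} \<times> {0..}) f" "\<forall>p\<in>{0..} \<times> {0..}. 0 \<le> f p"
    and \<rho>: "0 < \<rho>" and inf: "M_of k a b < (INF p\<in>P. f p / \<rho>)" and P: "P \<subseteq> {0..} \<times> {0..}"
    and uv: "continuous_on {0..1} u" "continuous_on {0..1} v"
      "\<And>s. s \<in> {0..1} \<Longrightarrow> 0 \<le> u s" "\<And>s. s \<in> {0..1} \<Longrightarrow> 0 \<le> v s"
      "\<And>s. s \<in> {a..b} \<Longrightarrow> (u s, v s) \<in> P"
    and t: "t \<in> {a..b}"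
  shows "\<rho> < hammerstein (\<lambda>s. f (u s, v s)) t"
proof -
  define F where "F = (INF p\<in>P. f p / \<rho>)"
  have bdd: "bdd_below ((\<lambda>p. f p / \<rho>) ` P)"
    by (rule bdd_belowI2[of _ 0]) (use f(2) P \<rho> in auto)
  have F: "F \<le> f p / \<rho>" if "p \<in> P" for p
    unfolding F_def by (rule cINF_lower[OF bdd that])
  have M: "0 < M_of k a b" by (rule M_of_pos)
  have "M_of k a b * \<rho> < F * \<rho>" using inf \<rho> by (simp add: F_def)
  then have "\<rho> < F * \<rho> / M_of k a b" using M by (simp add: field_simps)
  also have "\<dots> \<le> hammerstein (\<lambda>s. f (u s, v s)) t"
  proof (rule hammerstein_ge)
    show "continuous_on {0..1} (\<lambda>s. f (u s, v s))"
      by (rule continuous_on_compose2[OF f(1)]) (use uv in \<open>auto intro!: continuous_intros\<close>)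
    show "F * \<rho> \<le> f (u s, v s)" if "s \<in> {a..b}" for s
      using F[OF uv(5)[OF that]] \<rho> by (simp add: field_simps)
    show "0 \<le> F * \<rho>" using M inf \<rho> by (simp add: F_def)
  qed (use f(2) uv t in auto)
  finally show ?thesis .
qed

end

section \<open>The product cone and its functionals\<close>

definition ext_K :: "bcont_pair set" where
  "ext_K = ext_cone a1 b1 c1 \<times> ext_cone a2 b2 c2"

text \<open>The norm of the product type is the Euclidean one, hence a separate maximum norm.\<close>

definition pnorm :: "bcont_pair \<Rightarrow> real" where
  "pnorm w = max (norm (fst w)) (norm (snd w))"

text \<open>The maximum is chosen to fit I0: if it equals \<rho> on the cone, one component is at
  least \<rho> on its interval and all values lie in [0, \<rho>/c].\<close>

definition pmin :: "bcont_pair \<Rightarrow> real" where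
  "pmin w = max (min_on a1 b1 (fst w)) (min_on a2 b2 (snd w))"

definition eval_half :: "bcont_pair \<Rightarrow> real" where
  "eval_half w = fst w (1/2) + snd w (1/2)"

text \<open>The constant 1/2 normalises \<open>eval_half\<close> to 1.\<close>

definition unit_pair :: bcont_pair where
  "unit_pair = (const_bcontfun (1/2), const_bcontfun (1/2))"

definition to_C01 :: "bcont_pair \<Rightarrow> (real \<Rightarrow> real) \<times> (real \<Rightarrow> real)" where
  "to_C01 w = (restrict (fst w) {0..1}, restrict (snd w) {0..1})"

lemma ext_K_add: "w \<in> ext_K \<Longrightarrow> w' \<in> ext_K \<Longrightarrow> w + w' \<in> ext_K"
  by (auto simp: ext_K_def intro!: ext_cone_add)

lemma ext_K_scaleR: "w \<in> ext_K \<Longrightarrow> 0 \<le> r \<Longrightarrow> r *\<^sub>R w \<in> ext_K"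
  by (auto simp: ext_K_def intro!: ext_cone_scaleR)

lemma unit_pair_ext_K: "unit_pair \<in> ext_K"
  by (auto simp: ext_K_def unit_pair_def intro!: ext_cone_const k1.c k2.c)

lemma ext_K_ge_0:
  assumes "w \<in> ext_K"
  shows "0 \<le> fst w t" "0 \<le> snd w t"
  using assms ext_coneD(2) by (auto simp: ext_K_def)

lemma pnorm_bound:
  fixes w :: bcont_pair
  shows "\<bar>fst w t\<bar> \<le> pnorm w" "\<bar>snd w t\<bar> \<le> pnorm w"
  using norm_bounded[of "fst w" t] norm_bounded[of "snd w" t] by (auto simp: pnorm_def)

lemma pnorm_scaleR: "0 \<le> c \<Longrightarrow> pnorm (c *\<^sub>R w) = c * pnorm w"
  by (simp add: pnorm_def max_mult_distrib_left)

lemma pmin_scaleR: "0 \<le> c \<Longrightarrow> pmin (c *\<^sub>R w) = c * pmin w"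
  using k1.ab k2.ab by (simp add: pmin_def min_on_scaleR max_mult_distrib_left)

lemma continuous_on_pnorm: "continuous_on S pnorm"
  unfolding pnorm_def by (intro continuous_intros)

lemma continuous_on_pmin: "continuous_on S pmin"
  unfolding pmin_def
  by (intro continuous_on_max continuous_on_compose2[OF continuous_on_min_on[of a1 b1 UNIV]]
      continuous_on_compose2[OF continuous_on_min_on[of a2 b2 UNIV]])
    (use k1.ab k2.ab in \<open>auto intro!: continuous_intros\<close>)

lemma pmin_le_pnorm: "pmin w \<le> pnorm w"
  using min_on_le_norm[of a1 b1 "fst w"] min_on_le_norm[of a2 b2 "snd w"] k1.ab k2.ab
  by (auto simp: pmin_def pnorm_def)

text \<open>The factors are 4 = 1/c1 and 2 = 1/c2. For \<open>eval_half\<close> the point 1/2 is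
  used in both intervals, the other component contributing a nonnegative value.\<close>

lemma ext_K_norm:
  assumes "w \<in> ext_K"
  shows "pnorm w \<le> 4 * pmin w" "pnorm w \<le> 4 * eval_half w"
    "norm (fst w) \<le> 4 * min_on a1 b1 (fst w)" "norm (snd w) \<le> 2 * min_on a2 b2 (snd w)"
proof -
  have w: "fst w \<in> ext_cone a1 b1 c1" "snd w \<in> ext_cone a2 b2 c2"
    using assms by (auto simp: ext_K_def)
  note n = ext_cone_norm[OF w(1) k1.c(1)] ext_cone_norm[OF w(2) k2.c(1)]
  show m: "norm (fst w) \<le> 4 * min_on a1 b1 (fst w)" "norm (snd w) \<le> 2 * min_on a2 b2 (snd w)"
    using n(2,4) k1.ab k2.ab by (auto simp: c1_def c2_def)
  have "0 \<le> min_on a2 b2 (snd w)" using m(2) norm_ge_zero[of "snd w"] by linarith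
  with m show "pnorm w \<le> 4 * pmin w" by (auto simp: pnorm_def pmin_def)
  show "pnorm w \<le> 4 * eval_half w"
    using n(1)[of "1/2"] n(3)[of "1/2"] ext_K_ge_0[OF assms, of "1/2"]
    by (auto simp: pnorm_def eval_half_def a1_def b1_def a2_def b2_def c1_def c2_def)
qed

lemma bounded_linear_eval_half: "bounded_linear eval_half"
proof -
  have "bounded_linear (\<lambda>u :: real \<Rightarrow>\<^sub>C real. u t)" for t
  proof (rule bounded_linear_intro[of _ 1])
    show "norm (u t) \<le> norm u * 1" for u :: "real \<Rightarrow>\<^sub>C real" using norm_bounded[of u t] by simp
  qed simp_all
  then show ?thesis
    unfolding eval_half_def
    by (intro bounded_linear_add bounded_linear_compose[OF _ bounded_linear_fst]
        bounded_linear_compose[OF _ bounded_linear_snd])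
qed

lemma sup_norm_restrict:
  fixes u :: "real \<Rightarrow>\<^sub>C real"
  assumes "u \<in> ext_cone a b c"
  shows "sup_norm (restrict u {0..1}) = norm u"
proof (rule antisym)
  have bdd: "bdd_above ((\<lambda>t. \<bar>u t\<bar>) ` {0..1})"
    by (rule bdd_aboveI2[of _ _ "norm u"]) (use norm_bounded[of u] in simp)
  have eq: "sup_norm (restrict u {0..1}) = (SUP t\<in>{0..1}. \<bar>u t\<bar>)"
    unfolding sup_norm_def by (rule SUP_cong) auto
  show "sup_norm (restrict u {0..1}) \<le> norm u"
    unfolding eq by (rule cSUP_least) (use norm_bounded[of u] in auto)
  show "norm u \<le> sup_norm (restrict u {0..1})"
    unfolding eq
  proof (rule norm_bound)
    show "norm (u t) \<le> (SUP t\<in>{0..1}. \<bar>u t\<bar>)" for t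
      using cSUP_upper[OF clip_01(1) bdd, of t] ext_coneD(1)[OF assms, of t] by simp
  qed
qed

lemma restrict_cone_of:
  fixes u :: "real \<Rightarrow>\<^sub>C real"
  assumes u: "u \<in> ext_cone a b c" and c: "0 < c" and ab: "0 \<le> a" "a < b" "b \<le> 1"
  shows "restrict u {0..1} \<in> cone_of a b c"
proof -
  have "(INF t\<in>{a..b}. restrict u {0..1} t) = min_on a b u"
    unfolding min_on_def by (rule INF_cong) (use ab in auto)
  moreover have "continuous_on {0..1} (restrict u {0..1})"
    using continuous_on_cong[of "{0..1}" "{0..1}" "restrict u {0..1}" u] by simp
  ultimately show ?thesis
    using ext_cone_norm(2)[OF u c] ab ext_coneD(2)[OF u]
    by (auto simp: cone_of_def C01_def sup_norm_restrict[OF u])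
qed

text \<open>Values on [0,1] determine the constant extensions, so counting fixed points counts
  solutions.\<close>

lemma inj_on_to_C01: "inj_on to_C01 ext_K"
proof (rule inj_onI)
  have eq: "u = v" if uv: "u \<in> ext_cone a b c" "v \<in> ext_cone a b c" "restrict u {0..1} = restrict v {0..1}"
    for u v :: "real \<Rightarrow>\<^sub>C real" and a b c
  proof (rule bcontfun_eqI)
    fix t
    have "u (clip t) = v (clip t)"
      using fun_cong[OF uv(3), of "clip t"] by simp
    then show "u t = v t" using ext_coneD(1)[OF uv(1), of t] ext_coneD(1)[OF uv(2), of t] by simp
  qed
  show "x = y" if "x \<in> ext_K" "y \<in> ext_K" "to_C01 x = to_C01 y" for x y
    using that eq[of "fst x" _ _ _ "fst y"] eq[of "snd x" _ _ _ "snd y"]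
    by (auto simp: ext_K_def to_C01_def prod_eq_iff)
qed

section \<open>Compression and expansion for the system\<close>

locale hammerstein_system =
  fixes f1 f2 :: "real \<times> real \<Rightarrow> real"
  assumes cont: "continuous_on ({0..} \<times> {0..}) f1" "continuous_on ({0..} \<times> {0..}) f2"
    and nonneg: "\<forall>p\<in>{0..} \<times> {0..}. f1 p \<ge> 0" "\<forall>p\<in>{0..} \<times> {0..}. f2 p \<ge> 0"
begin

definition sys :: "bcont_pair \<Rightarrow> bcont_pair" where
  "sys w = (k1.hammerstein (superpose f1 w), k2.hammerstein (superpose f2 w))"

lemma continuous_superposition:
  assumes "w \<in> ext_K"
  shows "continuous_on {0..1} (superpose f1 w)" "continuous_on {0..1} (superpose f2 w)"
  by (rule continuous_on_compose2[OF cont(1)] continuous_on_compose2[OF cont(2)];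
      use ext_K_ge_0[OF assms] in \<open>auto intro!: continuous_intros\<close>)+

lemma sys_ext_K: "w \<in> ext_K \<Longrightarrow> sys w \<in> ext_K"
  using nonneg ext_K_ge_0 continuous_superposition
  by (auto simp: ext_K_def sys_def intro!: k1.hammerstein_in_cone k2.hammerstein_in_cone)

lemma fixed_point_positive_solution:
  assumes w: "w \<in> ext_K" and fp: "sys w = w" and pos: "0 < pnorm w"
  shows "to_C01 w \<in> positive_solutions f1 f2"
proof -
  have uv: "fst w \<in> ext_cone a1 b1 c1" "snd w \<in> ext_cone a2 b2 c2"
    using w by (auto simp: ext_K_def)
  have int: "integral {0..1} (\<lambda>s. kern t s * f (fst w s, snd w s)) =
      integral {0..1} (\<lambda>s. kern t s * f (restrict (fst w) {0..1} s, restrict (snd w) {0..1} s))"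
    for kern :: "real \<Rightarrow> real \<Rightarrow> real" and f t
    by (rule integral_cong) simp
  have "fst w t = integral {0..1} (\<lambda>s. kern1 t s * f1 (fst w s, snd w s))"
    "snd w t = integral {0..1} (\<lambda>s. kern2 t s * f2 (fst w s, snd w s))" if "t \<in> {0..1}" for t
  proof -
    have "fst w t = fst (sys w) t" "snd w t = snd (sys w) t" using fp by simp_all
    then show "fst w t = integral {0..1} (\<lambda>s. kern1 t s * f1 (fst w s, snd w s))"
      "snd w t = integral {0..1} (\<lambda>s. kern2 t s * f2 (fst w s, snd w s))"
      using that
      by (simp_all add: sys_def k1.hammerstein_apply k2.hammerstein_apply continuous_superposition[OF w])
  qed
  then have "solves_system f1 f2 (restrict (fst w) {0..1}) (restrict (snd w) {0..1})"
    unfolding solves_system_def int[symmetric] by simp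
  moreover have "pair_norm (to_C01 w) = pnorm w"
    by (simp add: pair_norm_def to_C01_def pnorm_def sup_norm_restrict[OF uv(1)] sup_norm_restrict[OF uv(2)])
  ultimately show ?thesis
    using pos restrict_cone_of[OF uv(1) k1.c(1) k1.ab] restrict_cone_of[OF uv(2) k2.c(1) k2.ab]
    by (simp add: positive_solutions_def cone_K_def to_C01_def)
qed

lemma at_least_positive_solutionsI:
  assumes "finite S" "S \<subseteq> {w \<in> ext_K. sys w = w \<and> 0 < pnorm w}"
  shows "at_least_positive_solutions (card S) f1 f2"
proof -
  have "inj_on to_C01 S" using inj_on_subset[OF inj_on_to_C01] assms(2) by blast
  then show ?thesis
    unfolding at_least_positive_solutions_def
    using assms fixed_point_positive_solution
    by (intro exI[of _ "to_C01 ` S"]) (auto simp: card_image)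
qed

lemma sys_compact:
  shows "continuous_on {w \<in> ext_K. pnorm w \<le> R} sys"
    and "\<exists>Y. compact Y \<and> Y \<subseteq> ext_K \<and> sys ` {w \<in> ext_K. pnorm w \<le> R} \<subseteq> Y"
proof -
  have sub: "{w \<in> ext_K. pnorm w \<le> R} \<subseteq> pair_box R"
  proof
    fix w
    assume "w \<in> {w \<in> ext_K. pnorm w \<le> R}"
    then have w: "w \<in> ext_K" "pnorm w \<le> R" by auto
    show "w \<in> pair_box R"
      using ext_K_ge_0[OF w(1)] order_trans[OF abs_le_D1[OF pnorm_bound(1)] w(2)]
        order_trans[OF abs_le_D1[OF pnorm_bound(2)] w(2)]
      by (simp add: pair_box_def)
  qed
  have f: "continuous_on ({0..R} \<times> {0..R}) f1" "continuous_on ({0..R} \<times> {0..R}) f2"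
    by (rule continuous_on_subset[OF cont(1)] continuous_on_subset[OF cont(2)]; force)+
  note k1 = k1.continuous_on_hammerstein_superposition[OF f(1)]
  note k2 = k2.continuous_on_hammerstein_superposition[OF f(2)]
  show "continuous_on {w \<in> ext_K. pnorm w \<le> R} sys"
    unfolding sys_def
    by (intro continuous_on_Pair continuous_on_subset[OF k1(1) sub] continuous_on_subset[OF k2(1) sub])
  obtain L1 where L1: "\<And>w. w \<in> pair_box R \<Longrightarrow> k1.hammerstein (superpose f1 w) \<in> lipschitz_ball L1"
    using k1(2) by blast
  obtain L2 where L2: "\<And>w. w \<in> pair_box R \<Longrightarrow> k2.hammerstein (superpose f2 w) \<in> lipschitz_ball L2"
    using k2(2) by blast
  show "\<exists>Y. compact Y \<and> Y \<subseteq> ext_K \<and> sys ` {w \<in> ext_K. pnorm w \<le> R} \<subseteq> Y"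
  proof (intro exI conjI)
    have "closed ext_K" unfolding ext_K_def by (intro closed_Times closed_ext_cone)
    then show "compact ((lipschitz_ball L1 \<times> lipschitz_ball L2) \<inter> ext_K)"
      by (intro compact_Int_closed compact_Times compact_lipschitz_ball)
    show "(lipschitz_ball L1 \<times> lipschitz_ball L2) \<inter> ext_K \<subseteq> ext_K" by blast
    show "sys ` {w \<in> ext_K. pnorm w \<le> R} \<subseteq> (lipschitz_ball L1 \<times> lipschitz_ball L2) \<inter> ext_K"
    proof (rule image_subsetI)
      fix w
      assume w: "w \<in> {w \<in> ext_K. pnorm w \<le> R}"
      then have "w \<in> pair_box R" using sub by blast
      then show "sys w \<in> (lipschitz_ball L1 \<times> lipschitz_ball L2) \<inter> ext_K"
        using L1 L2 sys_ext_K w unfolding sys_def by blast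
    qed
  qed
qed

lemma sys_annulus_fixed_point:
  fixes p q :: "bcont_pair \<Rightarrow> real" and \<sigma> :: real
  assumes p: "continuous_on ext_K p" "\<And>c w. 0 \<le> c \<Longrightarrow> p (c *\<^sub>R w) = c * p w"
    and q: "continuous_on ext_K q" "\<And>c w. 0 \<le> c \<Longrightarrow> q (c *\<^sub>R w) = c * q w"
    and pq: "\<And>w. w \<in> ext_K \<Longrightarrow> 0 < pnorm w \<Longrightarrow> 0 < q w \<and> q w < p w"
    and r: "0 < r" "\<And>w. w \<in> ext_K \<Longrightarrow> 1 \<le> p w \<Longrightarrow> r \<le> pnorm w"
    and R: "\<And>w. w \<in> ext_K \<Longrightarrow> q w \<le> 1 \<Longrightarrow> pnorm w \<le> R"
    and \<delta>: "0 < \<delta>"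
    and inner: "\<And>w \<eta> m. w \<in> ext_K \<Longrightarrow> p w = 1 \<Longrightarrow> 0 \<le> \<eta> \<Longrightarrow> \<eta> \<le> \<delta> \<Longrightarrow> 0 < m \<Longrightarrow>
      sys w + \<eta> *\<^sub>R unit_pair = m *\<^sub>R w \<Longrightarrow> 0 < \<sigma> * (m - 1)"
    and outer: "\<And>w \<eta> m. w \<in> ext_K \<Longrightarrow> q w = 1 \<Longrightarrow> 0 \<le> \<eta> \<Longrightarrow> \<eta> \<le> \<delta> \<Longrightarrow> 0 < m \<Longrightarrow>
      sys w + \<eta> *\<^sub>R unit_pair = m *\<^sub>R w \<Longrightarrow> \<sigma> * (m - 1) < 0"
    and \<sigma>: "\<sigma> \<noteq> 0"
  obtains w where "w \<in> ext_K" "sys w = w" "q w < 1" "1 < p w"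
proof -
  let ?A = "{w \<in> ext_K. q w \<le> 1 \<and> 1 \<le> p w}"
  have sub: "?A \<subseteq> {w \<in> ext_K. pnorm w \<le> R}" using R by blast
  obtain Y where Y: "compact Y" "Y \<subseteq> ext_K" "sys ` {w \<in> ext_K. pnorm w \<le> R} \<subseteq> Y"
    using sys_compact(2) by blast
  show ?thesis
  \<comment> \<open>On the annulus \<open>r \<le> pnorm w \<le> 4 * eval_half w\<close>, so
    \<open>eval_half w\<close> is at least r/4 and strictly exceeds r/8. The minimum with \<delta>
    keeps the perturbation within the range that \<open>inner\<close> and \<open>outer\<close>
    cover.\<close>
  proof (rule cone_annulus_fixed_point[of ext_K eval_half unit_pair p q sys Y "min \<delta> (r / 8)" \<sigma>])
    show "0 \<le> eval_half w" if "w \<in> ext_K" for w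
      using ext_K_ge_0[OF that] by (simp add: eval_half_def)
    show "eval_half unit_pair = 1" by (simp add: eval_half_def unit_pair_def)
    show "0 < q w \<and> q w < p w" if "w \<in> ext_K" "eval_half w = 1" for w
    proof (rule pq[OF that(1)])
      have "eval_half w \<le> 2 * pnorm w"
        using pnorm_bound[of w "1/2"] by (auto simp: eval_half_def)
      then show "0 < pnorm w" using that(2) by simp
    qed
    show "continuous_on ?A sys" by (rule continuous_on_subset[OF sys_compact(1) sub])
    show "sys ` ?A \<subseteq> Y" using Y(3) sub by blast
    show "min \<delta> (r / 8) < eval_half w" if "w \<in> ?A" for w
      using that r(2)[of w] ext_K_norm(2)[of w] r(1) by auto
    show "0 < min \<delta> (r / 8)" using \<delta> r(1) by simp
    show thesis if "w \<in> ext_K" "q w < 1" "1 < p w" "sys w = w" for w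
      using \<open>\<And>w. w \<in> ext_K \<Longrightarrow> sys w = w \<Longrightarrow> q w < 1 \<Longrightarrow> 1 < p w \<Longrightarrow> thesis\<close> that by blast
  qed (use inner outer p q Y \<sigma> in
      \<open>auto intro: ext_K_add ext_K_scaleR unit_pair_ext_K bounded_linear_eval_half\<close>)
qed

section \<open>Behaviour of the operator on the bounding surfaces\<close>

definition raises :: "real \<Rightarrow> bool" where
  "raises \<rho> \<longleftrightarrow> (\<forall>w\<in>ext_K. pmin w = \<rho> \<longrightarrow>
     (\<forall>t\<in>{a1..b1}. \<rho> < fst (sys w) t) \<or> (\<forall>t\<in>{a2..b2}. \<rho> < snd (sys w) t))"

text \<open>A uniform margin is built in, in contrast to \<open>raises\<close>, because the positive
  perturbation works against lowering.\<close>

definition lowers :: "real \<Rightarrow> bool" where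
  "lowers \<rho> \<longleftrightarrow> (\<exists>\<delta>>0. \<forall>w\<in>ext_K. pnorm w \<le> \<rho> \<longrightarrow> pnorm (sys w) \<le> \<rho> - \<delta>)"

text \<open>At a point where the raised component attains its minimum, which is at most \<rho>, the
  eigenvector equation gives \<rho> < m \<rho>.\<close>

lemma raises_multiplier:
  assumes "raises \<rho>" "0 < \<rho>" "w \<in> ext_K" "pmin w = \<rho>" "0 \<le> \<eta>" "0 < m"
    and eq: "sys w + \<eta> *\<^sub>R unit_pair = m *\<^sub>R w"
  shows "1 < m"
proof -
  have key: "1 < m" if a: "a \<le> b" "min_on a b u \<le> \<rho>" "\<forall>t\<in>{a..b}. \<rho> < m * u t" for a b u
  proof -
    obtain t where t: "t \<in> {a..b}" "u t = min_on a b u" using min_on_attained(1)[OF a(1)] by blast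
    have "\<rho> < m * u t" using a(3) t(1) by blast
    also have "\<dots> \<le> m * \<rho>" using a(2) t(2) assms(6) by simp
    finally have "1 * \<rho> < m * \<rho>" by simp
    then show ?thesis using assms(2) by (simp only: mult_less_cancel_right_pos)
  qed
  have "fst (sys w) t + \<eta> / 2 = m * fst w t" "snd (sys w) t + \<eta> / 2 = m * snd w t" for t
    using arg_cong[OF eq, of "\<lambda>w. apply_bcontfun (fst w) t"] arg_cong[OF eq, of "\<lambda>w. apply_bcontfun (snd w) t"]
    by (simp_all add: unit_pair_def)
  then have le: "fst (sys w) t \<le> m * fst w t" "snd (sys w) t \<le> m * snd w t" for t
    using assms(5) by (metis add_increasing2 divide_nonneg_pos zero_less_numeral order_refl)+
  have min: "min_on a1 b1 (fst w) \<le> \<rho>" "min_on a2 b2 (snd w) \<le> \<rho>"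
    using assms(4) by (auto simp: pmin_def)
  from assms(1,3,4) consider "\<forall>t\<in>{a1..b1}. \<rho> < fst (sys w) t" | "\<forall>t\<in>{a2..b2}. \<rho> < snd (sys w) t"
    unfolding raises_def by blast
  then show ?thesis
    using key[OF _ min(1)] key[OF _ min(2)] k1.ab k2.ab le by cases (meson less_le_trans less_imp_le)+
qed

text \<open>The perturbation has norm at most \<eta>/2, less than the margin, so m \<rho> stays
  below \<rho>.\<close>

lemma lowers_multiplier:
  assumes "lowers \<rho>" "0 < \<rho>"
  obtains \<delta> where "0 < \<delta>" "\<And>w \<eta> m. w \<in> ext_K \<Longrightarrow> pnorm w = \<rho> \<Longrightarrow> 0 \<le> \<eta> \<Longrightarrow> \<eta> \<le> \<delta> \<Longrightarrow> 0 < m \<Longrightarrow>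
    sys w + \<eta> *\<^sub>R unit_pair = m *\<^sub>R w \<Longrightarrow> m < 1"
proof -
  obtain \<delta> where \<delta>: "0 < \<delta>" "\<And>w. w \<in> ext_K \<Longrightarrow> pnorm w \<le> \<rho> \<Longrightarrow> pnorm (sys w) \<le> \<rho> - \<delta>"
    using assms(1) unfolding lowers_def by blast
  show ?thesis
  proof (rule that[OF \<delta>(1)])
    fix w \<eta> m
    assume w: "w \<in> ext_K" "pnorm w = \<rho>" and \<eta>: "0 \<le> \<eta>" "\<eta> \<le> \<delta>" and m: "0 < m"
      and eq: "sys w + \<eta> *\<^sub>R unit_pair = m *\<^sub>R w"
    have half: "norm (\<eta> *\<^sub>R const_bcontfun (1/2) :: real \<Rightarrow>\<^sub>C real) \<le> \<eta> / 2"
      by (rule norm_bound) (use \<eta>(1) in simp)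
    have "m * \<rho> = pnorm (sys w + \<eta> *\<^sub>R unit_pair)"
      using m w(2) by (simp add: eq pnorm_scaleR)
    also have "\<dots> \<le> pnorm (sys w) + \<eta> / 2"
      using norm_triangle_le[OF add_left_mono[OF half], of "fst (sys w)"]
        norm_triangle_le[OF add_left_mono[OF half], of "snd (sys w)"]
      by (auto simp: pnorm_def unit_pair_def)
    also have "\<dots> < 1 * \<rho>" using \<delta>(2)[OF w(1)] w(2) \<eta> \<delta>(1) by simp
    finally show "m < 1" using assms(2) by (simp only: mult_less_cancel_right_pos)
  qed
qed

text \<open>The annulus has inner functional \<open>pmin w / \<rho>\<close> and outer functional
  \<open>pnorm w / \<rho>'\<close>; the factor 4 in the hypothesis makes the first exceed the
  second.\<close>

lemma compression:
  assumes "raises \<rho>" "lowers \<rho>'" "0 < \<rho>" "4 * \<rho> < \<rho>'"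
  obtains w where "w \<in> ext_K" "sys w = w" "\<rho> < pmin w" "pnorm w < \<rho>'"
proof -
  have pos: "0 < \<rho>'" using assms(3,4) by simp
  obtain \<delta> where \<delta>: "0 < \<delta>" "\<And>w \<eta> m. w \<in> ext_K \<Longrightarrow> pnorm w = \<rho>' \<Longrightarrow> 0 \<le> \<eta> \<Longrightarrow> \<eta> \<le> \<delta> \<Longrightarrow> 0 < m \<Longrightarrow>
    sys w + \<eta> *\<^sub>R unit_pair = m *\<^sub>R w \<Longrightarrow> m < 1"
    using lowers_multiplier[OF assms(2) pos] by blast
  show ?thesis
  proof (rule sys_annulus_fixed_point[of "\<lambda>w. pmin w / \<rho>" "\<lambda>w. pnorm w / \<rho>'" \<rho> \<rho>' \<delta> 1])
    show "0 < pnorm w / \<rho>' \<and> pnorm w / \<rho>' < pmin w / \<rho>" if "w \<in> ext_K" "0 < pnorm w" for w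
    proof -
      have "pnorm w * \<rho> \<le> 4 * pmin w * \<rho>" using ext_K_norm(1)[OF that(1)] assms(3) by simp
      also have "\<dots> = pmin w * (4 * \<rho>)" by simp
      also have "\<dots> < pmin w * \<rho>'"
        using ext_K_norm(1)[OF that(1)] that(2) assms(4) by (intro mult_strict_left_mono) auto
      finally show ?thesis using that(2) pos assms(3) by (simp add: field_simps)
    qed
    show "\<rho> \<le> pnorm w" if "1 \<le> pmin w / \<rho>" for w
      using that pmin_le_pnorm[of w] assms(3) by (simp add: field_simps)
    show "0 < 1 * (m - 1)" if "w \<in> ext_K" "pmin w / \<rho> = 1" "0 \<le> \<eta>" "0 < m"
      "sys w + \<eta> *\<^sub>R unit_pair = m *\<^sub>R w" for w \<eta> m
      using raises_multiplier[OF assms(1,3) that(1) _ that(3-5)] that(2) by simp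
    show "1 * (m - 1) < 0" if "w \<in> ext_K" "pnorm w / \<rho>' = 1" "0 \<le> \<eta>" "\<eta> \<le> \<delta>" "0 < m"
      "sys w + \<eta> *\<^sub>R unit_pair = m *\<^sub>R w" for w \<eta> m
      using \<delta>(2)[OF that(1) _ that(3-6)] that(2) by simp
    show thesis if "w \<in> ext_K" "sys w = w" "pnorm w / \<rho>' < 1" "1 < pmin w / \<rho>" for w
      using \<open>\<And>w. w \<in> ext_K \<Longrightarrow> sys w = w \<Longrightarrow> \<rho> < pmin w \<Longrightarrow> pnorm w < \<rho>' \<Longrightarrow> thesis\<close>[of w] that
        pos assms(3) by simp
  qed (use \<delta>(1) assms(3) pos in
      \<open>auto simp: pmin_scaleR pnorm_scaleR intro!: continuous_intros continuous_on_pmin continuous_on_pnorm\<close>)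
qed

text \<open>The functionals trade places, and \<open>pmin w \<le> pnorm w\<close> with \<rho> <
  \<rho>' orders them. The outer surface bounds only \<open>pmin\<close>, hence the norm bound 4
  \<rho>'.\<close>

lemma expansion:
  assumes "lowers \<rho>" "raises \<rho>'" "0 < \<rho>" "\<rho> < \<rho>'"
  obtains w where "w \<in> ext_K" "sys w = w" "\<rho> < pnorm w" "pmin w < \<rho>'"
proof -
  have pos: "0 < \<rho>'" using assms(3,4) by simp
  obtain \<delta> where \<delta>: "0 < \<delta>" "\<And>w \<eta> m. w \<in> ext_K \<Longrightarrow> pnorm w = \<rho> \<Longrightarrow> 0 \<le> \<eta> \<Longrightarrow> \<eta> \<le> \<delta> \<Longrightarrow> 0 < m \<Longrightarrow>
    sys w + \<eta> *\<^sub>R unit_pair = m *\<^sub>R w \<Longrightarrow> m < 1"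
    using lowers_multiplier[OF assms(1,3)] by blast
  show ?thesis
  proof (rule sys_annulus_fixed_point[of "\<lambda>w. pnorm w / \<rho>" "\<lambda>w. pmin w / \<rho>'" \<rho> "4 * \<rho>'" \<delta> "-1"])
    show "0 < pmin w / \<rho>' \<and> pmin w / \<rho>' < pnorm w / \<rho>" if "w \<in> ext_K" "0 < pnorm w" for w
    proof -
      have "pmin w * \<rho> \<le> pnorm w * \<rho>" using pmin_le_pnorm[of w] assms(3) by simp
      also have "\<dots> < pnorm w * \<rho>'" using that(2) assms(4) by simp
      finally show ?thesis
        using ext_K_norm(1)[OF that(1)] that(2) pos assms(3) by (simp add: field_simps)
    qed
    show "pnorm w \<le> 4 * \<rho>'" if "w \<in> ext_K" "pmin w / \<rho>' \<le> 1" for w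
      using that(2) ext_K_norm(1)[OF that(1)] pos by (simp add: field_simps)
    show "0 < -1 * (m - 1)" if "w \<in> ext_K" "pnorm w / \<rho> = 1" "0 \<le> \<eta>" "\<eta> \<le> \<delta>" "0 < m"
      "sys w + \<eta> *\<^sub>R unit_pair = m *\<^sub>R w" for w \<eta> m
      using \<delta>(2)[OF that(1) _ that(3-6)] that(2) by simp
    show "-1 * (m - 1) < 0" if "w \<in> ext_K" "pmin w / \<rho>' = 1" "0 \<le> \<eta>" "0 < m"
      "sys w + \<eta> *\<^sub>R unit_pair = m *\<^sub>R w" for w \<eta> m
      using raises_multiplier[OF assms(2) pos that(1) _ that(3-5)] that(2) by simp
    show thesis if "w \<in> ext_K" "sys w = w" "pmin w / \<rho>' < 1" "1 < pnorm w / \<rho>" for w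
      using \<open>\<And>w. w \<in> ext_K \<Longrightarrow> sys w = w \<Longrightarrow> \<rho> < pnorm w \<Longrightarrow> pmin w < \<rho>' \<Longrightarrow> thesis\<close>[of w] that
        pos assms(3) by simp
  qed (use \<delta>(1) assms(3) pos in
      \<open>auto simp: pmin_scaleR pnorm_scaleR intro!: continuous_intros continuous_on_pmin continuous_on_pnorm\<close>)
qed

section \<open>From the growth conditions to the boundary behaviour\<close>

lemma lowersI:
  assumes "cond_I1 f1 f2 \<rho>" "0 < \<rho>"
  shows "lowers \<rho>"
proof -
  have c: "continuous_on ({0..\<rho>} \<times> {0..\<rho>}) f1" "continuous_on ({0..\<rho>} \<times> {0..\<rho>}) f2"
    by (rule continuous_on_subset[OF cont(1)] continuous_on_subset[OF cont(2)]; force)+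
  have n: "0 \<le> f1 p" "0 \<le> f2 p" if "p \<in> {0..\<rho>} \<times> {0..\<rho>}" for p
    using nonneg that by force+
  obtain \<delta>1 where 1: "0 < \<delta>1" "\<And>u v t. continuous_on {0..1} u \<Longrightarrow> continuous_on {0..1} v \<Longrightarrow>
    (\<And>s. s \<in> {0..1} \<Longrightarrow> (u s, v s) \<in> {0..\<rho>} \<times> {0..\<rho>}) \<Longrightarrow>
    k1.hammerstein (\<lambda>s. f1 (u s, v s)) t \<le> \<rho> - \<delta>1"
    using k1.hammerstein_superposition_less[OF c(1) n(1) assms(2)] assms(1)
    unfolding cond_I1_def m1_def by blast
  obtain \<delta>2 where 2: "0 < \<delta>2" "\<And>u v t. continuous_on {0..1} u \<Longrightarrow> continuous_on {0..1} v \<Longrightarrow>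
    (\<And>s. s \<in> {0..1} \<Longrightarrow> (u s, v s) \<in> {0..\<rho>} \<times> {0..\<rho>}) \<Longrightarrow>
    k2.hammerstein (\<lambda>s. f2 (u s, v s)) t \<le> \<rho> - \<delta>2"
    using k2.hammerstein_superposition_less[OF c(2) n(2) assms(2)] assms(1)
    unfolding cond_I1_def m2_def by blast
  have "pnorm (sys w) \<le> \<rho> - min \<delta>1 \<delta>2" if w: "w \<in> ext_K" "pnorm w \<le> \<rho>" for w
  proof -
    have "(fst w s, snd w s) \<in> {0..\<rho>} \<times> {0..\<rho>}" for s
      using ext_K_ge_0[OF w(1), of s] pnorm_bound[of w s] w(2) by simp
    then have "fst (sys w) t \<le> \<rho> - \<delta>1" "snd (sys w) t \<le> \<rho> - \<delta>2" for t
      using 1(2)[of "fst w" "snd w" t] 2(2)[of "fst w" "snd w" t] by (simp_all add: sys_def)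
    then have "norm (fst (sys w)) \<le> \<rho> - \<delta>1" "norm (snd (sys w)) \<le> \<rho> - \<delta>2"
      using ext_K_ge_0[OF sys_ext_K[OF w(1)]] by (auto intro!: norm_bound)
    then show ?thesis by (auto simp: pnorm_def)
  qed
  then show ?thesis unfolding lowers_def using 1(1) 2(1) by (intro exI[of _ "min \<delta>1 \<delta>2"]) auto
qed

lemma raisesI:
  assumes "cond_I0 f1 f2 \<rho> \<or> cond_I0_star f1 f2 \<rho>" "0 < \<rho>"
  shows "raises \<rho>"
  unfolding raises_def
proof (intro ballI impI)
  fix w
  assume w: "w \<in> ext_K" "pmin w = \<rho>"
  have cm: "\<rho> / cmin = 4 * \<rho>" by (simp add: cmin_def c1_def c2_def)
  have "pnorm w \<le> 4 * \<rho>" using ext_K_norm(1)[OF w(1)] w(2) by simp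
  then have uv: "0 \<le> fst w s" "0 \<le> snd w s" "fst w s \<le> 4 * \<rho>" "snd w s \<le> 4 * \<rho>" for s
    using ext_K_ge_0[OF w(1), of s] pnorm_bound[of w s] by auto
  have cuv: "continuous_on {0..1} (fst w)" "continuous_on {0..1} (snd w)" by simp_all
  have g1: "\<forall>t\<in>{a1..b1}. \<rho> < fst (sys w) t"
    if "M1 < (INF p\<in>P. f1 p / \<rho>)" "P \<subseteq> {0..} \<times> {0..}" "\<And>s. s \<in> {a1..b1} \<Longrightarrow> (fst w s, snd w s) \<in> P" for P
    using k1.hammerstein_superposition_greater[OF cont(1) nonneg(1) assms(2) that(1)[unfolded M1_def] that(2)
        cuv uv(1,2) that(3)] by (simp add: sys_def)
  have g2: "\<forall>t\<in>{a2..b2}. \<rho> < snd (sys w) t"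
    if "M2 < (INF p\<in>P. f2 p / \<rho>)" "P \<subseteq> {0..} \<times> {0..}" "\<And>s. s \<in> {a2..b2} \<Longrightarrow> (fst w s, snd w s) \<in> P" for P
    using k2.hammerstein_superposition_greater[OF cont(2) nonneg(2) assms(2) that(1)[unfolded M2_def] that(2)
        cuv uv(1,2) that(3)] by (simp add: sys_def)
  \<comment> \<open>Under I0 the component attaining the maximum in \<open>pmin w\<close> selects
    the inequality to use; the starred form covers all values in [0, \<rho>/c] and works for
    either.\<close>
  from assms(1) consider (both) "cond_I0 f1 f2 \<rho>" "min_on a1 b1 (fst w) = \<rho>"
    | (both') "cond_I0 f1 f2 \<rho>" "min_on a2 b2 (snd w) = \<rho>"
    | (star) "M1 < (INF p\<in>{0..\<rho>/cmin} \<times> {0..\<rho>/cmin}. f1 p / \<rho>)"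
    | (star') "M2 < (INF p\<in>{0..\<rho>/cmin} \<times> {0..\<rho>/cmin}. f2 p / \<rho>)"
    using w(2) by (auto simp: cond_I0_star_def pmin_def max_def split: if_splits)
  then show "(\<forall>t\<in>{a1..b1}. \<rho> < fst (sys w) t) \<or> (\<forall>t\<in>{a2..b2}. \<rho> < snd (sys w) t)"
  proof cases
    case both
    have "\<rho> \<le> fst w s" if "s \<in> {a1..b1}" for s
      using min_on_attained(2)[OF less_imp_le[OF k1.ab(2)] that, of "fst w"] both(2) by simp
    then show ?thesis
      using both(1) assms(2) uv unfolding cond_I0_def cm
      by (intro disjI1 g1[of "{\<rho>..4 * \<rho>} \<times> {0..4 * \<rho>}"]) auto
  next
    case both'
    have "\<rho> \<le> snd w s" if "s \<in> {a2..b2}" for s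
      using min_on_attained(2)[OF less_imp_le[OF k2.ab(2)] that, of "snd w"] both'(2) by simp
    then show ?thesis
      using both'(1) assms(2) uv unfolding cond_I0_def cm
      by (intro disjI2 g2[of "{0..4 * \<rho>} \<times> {\<rho>..4 * \<rho>}"]) auto
  next
    case star
    then show ?thesis
      using uv unfolding cm by (intro disjI1 g1[of "{0..4 * \<rho>} \<times> {0..4 * \<rho>}"]) auto
  next
    case star'
    then show ?thesis
      using uv unfolding cm by (intro disjI2 g2[of "{0..4 * \<rho>} \<times> {0..4 * \<rho>}"]) auto
  qed
qed

end

section \<open>Counting solutions in neighbouring annuli\<close>

theorem theorem3p0p5:
  fixes f1 f2 :: "real \<times> real \<Rightarrow> real"
  assumes cont: "continuous_on ({0..} \<times> {0..}) f1" "continuous_on ({0..} \<times> {0..}) f2"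
    and nonneg: "\<forall>p\<in>{0..} \<times> {0..}. f1 p \<ge> 0" "\<forall>p\<in>{0..} \<times> {0..}. f2 p \<ge> 0"
  shows
    "((\<exists>\<rho>1>0. \<exists>\<rho>2>0. \<rho>1 / cmin < \<rho>2 \<and>
         (cond_I0 f1 f2 \<rho>1 \<or> cond_I0_star f1 f2 \<rho>1) \<and> cond_I1 f1 f2 \<rho>2) \<or>
      (\<exists>\<rho>1>0. \<exists>\<rho>2>0. \<rho>1 < \<rho>2 \<and> cond_I1 f1 f2 \<rho>1 \<and> cond_I0 f1 f2 \<rho>2)
        \<longrightarrow> at_least_positive_solutions 1 f1 f2) \<and>
     ((\<exists>\<rho>1>0. \<exists>\<rho>2>0. \<exists>\<rho>3>0. \<rho>1 / cmin < \<rho>2 \<and> \<rho>2 < \<rho>3 \<and>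
         (cond_I0 f1 f2 \<rho>1 \<or> cond_I0_star f1 f2 \<rho>1) \<and> cond_I1 f1 f2 \<rho>2 \<and> cond_I0 f1 f2 \<rho>3) \<or>
      (\<exists>\<rho>1>0. \<exists>\<rho>2>0. \<exists>\<rho>3>0. \<rho>1 < \<rho>2 \<and> \<rho>2 / cmin < \<rho>3 \<and>
         cond_I1 f1 f2 \<rho>1 \<and> cond_I0 f1 f2 \<rho>2 \<and> cond_I1 f1 f2 \<rho>3)
        \<longrightarrow> at_least_positive_solutions 2 f1 f2) \<and>
     ((\<exists>\<rho>1>0. \<exists>\<rho>2>0. \<exists>\<rho>3>0. \<exists>\<rho>4>0. \<rho>1 / cmin < \<rho>2 \<and> \<rho>2 < \<rho>3 \<and> \<rho>3 / cmin < \<rho>4 \<and>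
         (cond_I0 f1 f2 \<rho>1 \<or> cond_I0_star f1 f2 \<rho>1) \<and> cond_I1 f1 f2 \<rho>2 \<and>
         cond_I0 f1 f2 \<rho>3 \<and> cond_I1 f1 f2 \<rho>4) \<or>
      (\<exists>\<rho>1>0. \<exists>\<rho>2>0. \<exists>\<rho>3>0. \<exists>\<rho>4>0. \<rho>1 < \<rho>2 \<and> \<rho>2 / cmin < \<rho>3 \<and> \<rho>3 < \<rho>4 \<and>
         cond_I1 f1 f2 \<rho>1 \<and> cond_I0 f1 f2 \<rho>2 \<and> cond_I1 f1 f2 \<rho>3 \<and> cond_I0 f1 f2 \<rho>4)
        \<longrightarrow> at_least_positive_solutions 3 f1 f2)"
proof -
  interpret hammerstein_system f1 f2 by unfold_locales (fact cont nonneg)+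
  let ?I0 = "cond_I0 f1 f2" and ?I1 = "cond_I1 f1 f2" and ?Is = "cond_I0_star f1 f2"
  have cm: "\<rho> / cmin = 4 * \<rho>" for \<rho> by (simp add: cmin_def c1_def c2_def)
  have comp: "\<exists>w\<in>ext_K. sys w = w \<and> 0 < pnorm w \<and> \<rho> < pmin w \<and> pnorm w < \<rho>'"
    if h: "?I0 \<rho> \<or> ?Is \<rho>" "?I1 \<rho>'" "0 < \<rho>" "\<rho> / cmin < \<rho>'" for \<rho> \<rho>'
  proof -
    have "0 < \<rho>'" "4 * \<rho> < \<rho>'" using h(3,4) by (simp_all add: cm)
    then obtain w where w: "w \<in> ext_K" "sys w = w" "\<rho> < pmin w" "pnorm w < \<rho>'"
      using compression[OF raisesI[OF h(1,3)] lowersI[OF h(2)] h(3)] by blast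
    then show ?thesis using pmin_le_pnorm[of w] h(3) by force
  qed
  have expa: "\<exists>w\<in>ext_K. sys w = w \<and> 0 < pnorm w \<and> \<rho> < pnorm w \<and> pmin w < \<rho>'"
    if h: "?I1 \<rho>" "?I0 \<rho>'" "0 < \<rho>" "\<rho> < \<rho>'" for \<rho> \<rho>'
  proof -
    have "0 < \<rho>'" using h(3,4) by simp
    then obtain w where "w \<in> ext_K" "sys w = w" "\<rho> < pnorm w" "pmin w < \<rho>'"
      using expansion[OF lowersI[OF h(1,3)] raisesI[OF disjI1[OF h(2)]] h(3,4)] by blast
    then show ?thesis using h(3) by force
  qed
  let ?FP = "{w \<in> ext_K. sys w = w \<and> 0 < pnorm w}"
  have one: "at_least_positive_solutions 1 f1 f2" if h: "x \<in> ?FP" for x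
    using at_least_positive_solutionsI[of "{x}"] that by simp
  have two: "at_least_positive_solutions 2 f1 f2" if h: "x \<in> ?FP" "y \<in> ?FP" "x \<noteq> y" for x y
    using at_least_positive_solutionsI[of "{x, y}"] that by (simp add: numeral_2_eq_2)
  have three: "at_least_positive_solutions 3 f1 f2"
    if h: "x \<in> ?FP" "y \<in> ?FP" "z \<in> ?FP" "x \<noteq> y" "x \<noteq> z" "y \<noteq> z" for x y z
    using at_least_positive_solutionsI[of "{x, y, z}"] that by (simp add: numeral_3_eq_3)
  have S1: "at_least_positive_solutions 1 f1 f2"
    if h: "0 < \<rho>1" "\<rho>1 / cmin < \<rho>2" "?I0 \<rho>1 \<or> ?Is \<rho>1" "?I1 \<rho>2" for \<rho>1 \<rho>2
    using comp[OF h(3,4,1,2)] one by blast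
  have S2: "at_least_positive_solutions 1 f1 f2"
    if h: "0 < \<rho>1" "\<rho>1 < \<rho>2" "?I1 \<rho>1" "?I0 \<rho>2" for \<rho>1 \<rho>2
    using expa[OF h(3,4,1,2)] one by blast
  have S3: "at_least_positive_solutions 2 f1 f2"
    if h: "0 < \<rho>1" "0 < \<rho>2" "\<rho>1 / cmin < \<rho>2" "\<rho>2 < \<rho>3" "?I0 \<rho>1 \<or> ?Is \<rho>1" "?I1 \<rho>2" "?I0 \<rho>3"
    for \<rho>1 \<rho>2 \<rho>3
  proof -
    obtain x where "x \<in> ?FP" "pnorm x < \<rho>2" using comp[OF h(5,6,1,3)] by blast
    moreover obtain y where "y \<in> ?FP" "\<rho>2 < pnorm y" using expa[OF h(6,7,2,4)] by blast
    moreover have "x \<noteq> y" using calculation by auto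
    ultimately show ?thesis by (intro two)
  qed
  have S4: "at_least_positive_solutions 2 f1 f2"
    if h: "0 < \<rho>1" "0 < \<rho>2" "\<rho>1 < \<rho>2" "\<rho>2 / cmin < \<rho>3" "?I1 \<rho>1" "?I0 \<rho>2" "?I1 \<rho>3"
    for \<rho>1 \<rho>2 \<rho>3
  proof -
    obtain x where "x \<in> ?FP" "pmin x < \<rho>2" using expa[OF h(5,6,1,3)] by blast
    moreover obtain y where "y \<in> ?FP" "\<rho>2 < pmin y" using comp[OF disjI1[OF h(6)] h(7,2,4)] by blast
    moreover have "x \<noteq> y" using calculation by auto
    ultimately show ?thesis by (intro two)
  qed
  have S5: "at_least_positive_solutions 3 f1 f2"
    if h: "0 < \<rho>1" "0 < \<rho>2" "0 < \<rho>3" "\<rho>1 / cmin < \<rho>2" "\<rho>2 < \<rho>3" "\<rho>3 / cmin < \<rho>4"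
      "?I0 \<rho>1 \<or> ?Is \<rho>1" "?I1 \<rho>2" "?I0 \<rho>3" "?I1 \<rho>4" for \<rho>1 \<rho>2 \<rho>3 \<rho>4
  proof -
    obtain x where x: "x \<in> ?FP" "pnorm x < \<rho>2" using comp[OF h(7,8,1,4)] by blast
    obtain y where y: "y \<in> ?FP" "\<rho>2 < pnorm y" "pmin y < \<rho>3" using expa[OF h(8,9,2,5)] by blast
    obtain z where z: "z \<in> ?FP" "\<rho>3 < pmin z" using comp[OF disjI1[OF h(9)] h(10,3,6)] by blast
    have "x \<noteq> y" "y \<noteq> z" using x y z by auto
    \<comment> \<open>Different functionals bound these two:
      \<open>pnorm x < \<rho>2 < \<rho>3 < pmin z \<le> pnorm z\<close>.\<close>
    moreover have "x \<noteq> z" using x z pmin_le_pnorm[of z] h(5) by auto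
    ultimately show ?thesis using three[OF x(1) y(1) z(1)] by blast
  qed
  have S6: "at_least_positive_solutions 3 f1 f2"
    if h: "0 < \<rho>1" "0 < \<rho>2" "0 < \<rho>3" "\<rho>1 < \<rho>2" "\<rho>2 / cmin < \<rho>3" "\<rho>3 < \<rho>4"
      "?I1 \<rho>1" "?I0 \<rho>2" "?I1 \<rho>3" "?I0 \<rho>4" for \<rho>1 \<rho>2 \<rho>3 \<rho>4
  proof -
    obtain x where x: "x \<in> ?FP" "pmin x < \<rho>2" using expa[OF h(7,8,1,4)] by blast
    obtain y where y: "y \<in> ?FP" "\<rho>2 < pmin y" "pnorm y < \<rho>3"
      using comp[OF disjI1[OF h(8)] h(9,2,5)] by blast
    obtain z where z: "z \<in> ?FP" "\<rho>3 < pnorm z" using expa[OF h(9,10,3,6)] by blast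
    have "x \<noteq> y" "y \<noteq> z" using x y z by auto
    \<comment> \<open>Here the gap \<rho>2/c < \<rho>3 is what separates:
      \<open>pnorm x \<le> 4 * pmin x < 4 * \<rho>2 < \<rho>3 < pnorm z\<close>.\<close>
    moreover have "x \<noteq> z" using x z ext_K_norm(1)[of x] h(5) by (auto simp: cm)
    ultimately show ?thesis using three[OF x(1) y(1) z(1)] by blast
  qed
  show ?thesis
    by (intro conjI impI; elim disjE exE conjE) (blast intro: S1 S2 S3 S4 S5 S6)+
qed

end
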